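(* Let $H$ be a finitely generated free abelian group, and let $k\ge 1$. Then the sequence $$0\to \mathsf{L}_k(H)\otimes\mathbb{Z}/2\xrightarrow{\ \theta_k\ }\mathsf{L}'_{2k}(H)\xrightarrow{\ \gamma_{2k}\ }\mathsf{L}_{2k}(H)\to 0$$ is exact (and therefore split exact).
   Context: $\mathsf{L}(H)=\bigoplus_n\mathsf{L}_n(H)$ is the free Lie algebra over $\mathbb{Z}$ on $H$, graded with $H$ in degree $1$ (so $[\alpha,\alpha]=0$ for all $\alpha$). A quasi-Lie algebra (over $\mathbb{Z}$) is an abelian group with a bilinear bracket satisfying $[\alpha,\beta]+[\beta,\alpha]=0$ and the Jacobi identity $[[\alpha,\beta],\gamma]+[[\beta,\gamma],\alpha]+[[\gamma,\alpha],\beta]=0$; the relation $[\alpha,\alpha]=0$ is not required. $\mathsf{L}'(H)=\bigoplus_n \mathsf{L}'_n(H)$ is the free quasi-Lie algebra on $H$, graded with $H$ in degree $1$. $\gamma_n:\mathsf{L}'_n(H)\to\mathsf{L}_n(H)$ is the canonical epimorphism (the degree $n$ part of the bracket-preserving map which is the identity on $H$). $\theta_k:\mathsf{L}_k(H)\otimes\mathbb{Z}/2\to\mathsf{L}'_{2k}(H)$ is the homomorphism defined by $\theta_k(\alpha\otimes 1)=[\tilde\alpha,\tilde\alpha]$, where $\tilde\alpha\in\mathsf{L}'_k(H)$ is any lift of $\alpha\in\mathsf{L}_k(H)$, i.e. $\gamma_k(\tilde\alpha)=\alpha$ (this is well defined). *)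

theory Defs
  imports "HOL-Algebra.Algebra"
begin


section \<open>Quasi-Lie algebras and Lie algebras over the integers\<close>

text \<open>
  The underlying abelian group is written multiplicatively, as everywhere in the group theory
  of \<open>HOL-Algebra\<close>: \<open>x \<otimes> y\<close> is the sum and \<open>\<one>\<close> is zero.
\<close>

record 'a lie_ring = "'a monoid" +
  bracket :: "'a \<Rightarrow> 'a \<Rightarrow> 'a"

locale quasi_lie_algebra = comm_group L for L :: "('a, 'm) lie_ring_scheme" (structure) +
  assumes bracket_closed:
      "\<lbrakk>x \<in> carrier L; y \<in> carrier L\<rbrakk> \<Longrightarrow> bracket L x y \<in> carrier L"
    and bracket_mult_left:
      "\<lbrakk>x \<in> carrier L; y \<in> carrier L; z \<in> carrier L\<rbrakk>
        \<Longrightarrow> bracket L (x \<otimes> y) z = bracket L x z \<otimes> bracket L y z"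
    and bracket_mult_right:
      "\<lbrakk>x \<in> carrier L; y \<in> carrier L; z \<in> carrier L\<rbrakk>
        \<Longrightarrow> bracket L z (x \<otimes> y) = bracket L z x \<otimes> bracket L z y"
    and bracket_antisym:
      "\<lbrakk>x \<in> carrier L; y \<in> carrier L\<rbrakk> \<Longrightarrow> bracket L x y \<otimes> bracket L y x = \<one>"
    and jacobi:
      "\<lbrakk>x \<in> carrier L; y \<in> carrier L; z \<in> carrier L\<rbrakk>
        \<Longrightarrow> bracket L (bracket L x y) z \<otimes> bracket L (bracket L y z) x
              \<otimes> bracket L (bracket L z x) y = \<one>"

locale lie_algebra = quasi_lie_algebra +
  assumes bracket_self: "x \<in> carrier L \<Longrightarrow> bracket L x x = \<one>"

definition lie_hom ::
  "('a, 'm) lie_ring_scheme \<Rightarrow> ('b, 'n) lie_ring_scheme \<Rightarrow> ('a \<Rightarrow> 'b) set" where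
  "lie_hom L M = {f \<in> hom L M. \<forall>x \<in> carrier L. \<forall>y \<in> carrier L.
      f (bracket L x y) = bracket M (f x) (f y)}"


section \<open>The free quasi-Lie algebra and the free Lie algebra on an abelian group\<close>

text \<open>
  Both are quotients of the free nonassociative ring on the set \<open>carrier H\<close>, whose underlying
  abelian group is free on the nonassociative words in that set.  One of the relators imposed
  makes the inclusion of generators additive, so that the result is free on the abelian group
  \<open>H\<close> and not on its underlying set.
\<close>

datatype 'h lie_word = Gen 'h | Br "'h lie_word" "'h lie_word"

primrec weight :: "'h lie_word \<Rightarrow> nat" where
  "weight (Gen h) = 1"
| "weight (Br u v) = weight u + weight v"

definition lie_words :: "('h, 'm) monoid_scheme \<Rightarrow> 'h lie_word set" where
  "lie_words H = {w. set_lie_word w \<subseteq> carrier H}"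

abbreviation nonassoc :: "('h, 'm) monoid_scheme \<Rightarrow> ('h lie_word \<Rightarrow>\<^sub>0 int) monoid" where
  "nonassoc H \<equiv> free_Abelian_group (lie_words H)"

definition br ::
  "('h lie_word \<Rightarrow>\<^sub>0 int) \<Rightarrow> ('h lie_word \<Rightarrow>\<^sub>0 int) \<Rightarrow> ('h lie_word \<Rightarrow>\<^sub>0 int)" where
  "br x y = frag_extend (\<lambda>u. frag_extend (\<lambda>v. frag_of (Br u v)) y) x"

inductive_set nonassoc_ideal ::
  "('h, 'm) monoid_scheme \<Rightarrow> ('h lie_word \<Rightarrow>\<^sub>0 int) set \<Rightarrow> ('h lie_word \<Rightarrow>\<^sub>0 int) set"
  for H R where
  base: "r \<in> R \<Longrightarrow> r \<in> nonassoc_ideal H R"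
| zero: "0 \<in> nonassoc_ideal H R"
| diff: "\<lbrakk>x \<in> nonassoc_ideal H R; y \<in> nonassoc_ideal H R\<rbrakk> \<Longrightarrow> x - y \<in> nonassoc_ideal H R"
| left: "\<lbrakk>x \<in> nonassoc_ideal H R; y \<in> carrier (nonassoc H)\<rbrakk> \<Longrightarrow> br y x \<in> nonassoc_ideal H R"
| right: "\<lbrakk>x \<in> nonassoc_ideal H R; y \<in> carrier (nonassoc H)\<rbrakk> \<Longrightarrow> br x y \<in> nonassoc_ideal H R"

definition quasi_lie_relators :: "('h, 'm) monoid_scheme \<Rightarrow> ('h lie_word \<Rightarrow>\<^sub>0 int) set" where
  "quasi_lie_relators H =
      {frag_of (Gen (a \<otimes>\<^bsub>H\<^esub> b)) - (frag_of (Gen a) + frag_of (Gen b)) | a b.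
         a \<in> carrier H \<and> b \<in> carrier H}
    \<union> {br x y + br y x | x y. x \<in> carrier (nonassoc H) \<and> y \<in> carrier (nonassoc H)}
    \<union> {br (br x y) z + br (br y z) x + br (br z x) y | x y z.
         x \<in> carrier (nonassoc H) \<and> y \<in> carrier (nonassoc H) \<and> z \<in> carrier (nonassoc H)}"

definition lie_relators :: "('h, 'm) monoid_scheme \<Rightarrow> ('h lie_word \<Rightarrow>\<^sub>0 int) set" where
  "lie_relators H = quasi_lie_relators H \<union> {br x x | x. x \<in> carrier (nonassoc H)}"

definition nonassoc_quot ::
  "('h, 'm) monoid_scheme \<Rightarrow> ('h lie_word \<Rightarrow>\<^sub>0 int) set \<Rightarrow> ('h lie_word \<Rightarrow>\<^sub>0 int) set lie_ring" where
  "nonassoc_quot H I =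
     \<lparr>carrier = carrier (nonassoc H Mod I), monoid.mult = monoid.mult (nonassoc H Mod I),
      one = one (nonassoc H Mod I),
      bracket = (\<lambda>U V. \<Union>x\<in>U. \<Union>y\<in>V. I #>\<^bsub>nonassoc H\<^esub> br x y)\<rparr>"

definition free_quasi_lie ::
  "('h, 'm) monoid_scheme \<Rightarrow> ('h lie_word \<Rightarrow>\<^sub>0 int) set lie_ring" where
  "free_quasi_lie H = nonassoc_quot H (nonassoc_ideal H (quasi_lie_relators H))"

definition free_lie ::
  "('h, 'm) monoid_scheme \<Rightarrow> ('h lie_word \<Rightarrow>\<^sub>0 int) set lie_ring" where
  "free_lie H = nonassoc_quot H (nonassoc_ideal H (lie_relators H))"

definition quasi_lie_gen :: "('h, 'm) monoid_scheme \<Rightarrow> 'h \<Rightarrow> ('h lie_word \<Rightarrow>\<^sub>0 int) set" where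
  "quasi_lie_gen H h = nonassoc_ideal H (quasi_lie_relators H) #>\<^bsub>nonassoc H\<^esub> frag_of (Gen h)"

definition lie_gen :: "('h, 'm) monoid_scheme \<Rightarrow> 'h \<Rightarrow> ('h lie_word \<Rightarrow>\<^sub>0 int) set" where
  "lie_gen H h = nonassoc_ideal H (lie_relators H) #>\<^bsub>nonassoc H\<^esub> frag_of (Gen h)"

text \<open>
  The homogeneous parts \<open>L'\<^sub>n(H)\<close> and \<open>L\<^sub>n(H)\<close> are the subgroups spanned by the \<open>n\<close>-fold brackets
  of elements of \<open>H\<close>.  They are used as groups only; their \<open>bracket\<close> field is inherited from the
  ambient record and does not map into the part.
\<close>

definition quasi_lie_part ::
  "('h, 'm) monoid_scheme \<Rightarrow> nat \<Rightarrow> ('h lie_word \<Rightarrow>\<^sub>0 int) set lie_ring" where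
  "quasi_lie_part H n = subgroup_generated (free_quasi_lie H)
     ((\<lambda>w. nonassoc_ideal H (quasi_lie_relators H) #>\<^bsub>nonassoc H\<^esub> frag_of w)
        ` {w \<in> lie_words H. weight w = n})"

definition lie_part ::
  "('h, 'm) monoid_scheme \<Rightarrow> nat \<Rightarrow> ('h lie_word \<Rightarrow>\<^sub>0 int) set lie_ring" where
  "lie_part H n = subgroup_generated (free_lie H)
     ((\<lambda>w. nonassoc_ideal H (lie_relators H) #>\<^bsub>nonassoc H\<^esub> frag_of w)
        ` {w \<in> lie_words H. weight w = n})"


section \<open>Tensor products of abelian groups\<close>

definition tensor_relators ::
  "('a, 'm) monoid_scheme \<Rightarrow> ('b, 'n) monoid_scheme \<Rightarrow> ('a \<times> 'b \<Rightarrow>\<^sub>0 int) set" where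
  "tensor_relators A B =
      {frag_of (a \<otimes>\<^bsub>A\<^esub> a', b) - (frag_of (a, b) + frag_of (a', b)) | a a' b.
         a \<in> carrier A \<and> a' \<in> carrier A \<and> b \<in> carrier B}
    \<union> {frag_of (a, b \<otimes>\<^bsub>B\<^esub> b') - (frag_of (a, b) + frag_of (a, b')) | a b b'.
         a \<in> carrier A \<and> b \<in> carrier B \<and> b' \<in> carrier B}"

definition tensor_kernel ::
  "('a, 'm) monoid_scheme \<Rightarrow> ('b, 'n) monoid_scheme \<Rightarrow> ('a \<times> 'b \<Rightarrow>\<^sub>0 int) set" where
  "tensor_kernel A B =
     generate (free_Abelian_group (carrier A \<times> carrier B)) (tensor_relators A B)"

definition tensor ::
  "('a, 'm) monoid_scheme \<Rightarrow> ('b, 'n) monoid_scheme \<Rightarrow> ('a \<times> 'b \<Rightarrow>\<^sub>0 int) set monoid" where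
  "tensor A B = free_Abelian_group (carrier A \<times> carrier B) Mod tensor_kernel A B"

definition pure_tensor ::
  "('a, 'm) monoid_scheme \<Rightarrow> ('b, 'n) monoid_scheme \<Rightarrow> 'a \<Rightarrow> 'b \<Rightarrow> ('a \<times> 'b \<Rightarrow>\<^sub>0 int) set" where
  "pure_tensor A B a b =
     tensor_kernel A B #>\<^bsub>free_Abelian_group (carrier A \<times> carrier B)\<^esub> frag_of (a, b)"


section \<open>The maps\<close>

text \<open>
  Both ideals live in the same nonassociative ring, so the canonical map sends a coset of the
  smaller one to the coset of the larger one containing it.  It is the map given by
  \<open>free_quasi_lie_universal\<close>; see \<open>quasi_lie_to_lie_hom\<close>.
\<close>

definition quasi_lie_to_lie ::
  "('h, 'm) monoid_scheme \<Rightarrow> ('h lie_word \<Rightarrow>\<^sub>0 int) set \<Rightarrow> ('h lie_word \<Rightarrow>\<^sub>0 int) set" where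
  "quasi_lie_to_lie H = (\<lambda>U \<in> carrier (free_quasi_lie H).
     \<Union>x\<in>U. nonassoc_ideal H (lie_relators H) #>\<^bsub>nonassoc H\<^esub> x)"

definition gamma ::
  "('h, 'm) monoid_scheme \<Rightarrow> nat \<Rightarrow> ('h lie_word \<Rightarrow>\<^sub>0 int) set \<Rightarrow> ('h lie_word \<Rightarrow>\<^sub>0 int) set" where
  "gamma H n = restrict (quasi_lie_to_lie H) (carrier (quasi_lie_part H n))"

text \<open>
  \<open>theta_ex1\<close> below proves that this description determines exactly one map; it includes the
  independence of the choice of the lift \<open>a\<close> of \<open>gamma H k a\<close>.
\<close>

definition theta ::
  "('h, 'm) monoid_scheme \<Rightarrow> nat
     \<Rightarrow> (('h lie_word \<Rightarrow>\<^sub>0 int) set \<times> int \<Rightarrow>\<^sub>0 int) set \<Rightarrow> ('h lie_word \<Rightarrow>\<^sub>0 int) set" where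
  "theta H k = (THE f.
     f \<in> extensional (carrier (tensor (lie_part H k) (integer_mod_group 2))) \<and>
     f \<in> hom (tensor (lie_part H k) (integer_mod_group 2)) (quasi_lie_part H (2 * k)) \<and>
     (\<forall>a \<in> carrier (quasi_lie_part H k).
        f (pure_tensor (lie_part H k) (integer_mod_group 2) (gamma H k a) 1)
          = bracket (free_quasi_lie H) a a))"


section \<open>Exactness\<close>

text \<open>The library's \<open>exact_seq\<close> needs all groups of the sequence to have the same type.\<close>

definition short_exact ::
  "('a, 'l) monoid_scheme \<Rightarrow> ('a \<Rightarrow> 'b) \<Rightarrow> ('b, 'm) monoid_scheme \<Rightarrow> ('b \<Rightarrow> 'c)
     \<Rightarrow> ('c, 'n) monoid_scheme \<Rightarrow> bool" where
  "short_exact A f B g C \<longleftrightarrow> group A \<and> group B \<and> group C \<and>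
     f \<in> mon A B \<and> f ` carrier A = kernel B C g \<and> g \<in> epi B C"


section \<open>The quotients are quasi-Lie and Lie algebras\<close>

lemma frag_eqI:
  assumes "Poly_Mapping.keys x \<subseteq> S"
    and "\<And>a b. f (a - b) = f a - (f b :: 'b :: ab_group_add)"
    and "\<And>a b. g (a - b) = g a - (g b :: 'b)"
    and "\<And>w. w \<in> S \<Longrightarrow> f (frag_of w) = g (frag_of w)"
  shows "f x = g x"
  using assms(1)
proof (induction x rule: frag_induction)
  case zero
  show ?case using assms(2)[of 0 0] assms(3)[of 0 0] by simp
qed (use assms in auto)

lemma frag_coset:
  "I #>\<^bsub>free_Abelian_group S\<^esub> x = (\<lambda>i. i + x) ` I"
  by (auto simp: r_coset_def)

lemma frag_coset_eq:
  assumes "0 \<in> I" "\<And>x y. x \<in> I \<Longrightarrow> y \<in> I \<Longrightarrow> x - y \<in> I"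
  shows "I #>\<^bsub>free_Abelian_group S\<^esub> x = I #>\<^bsub>free_Abelian_group S\<^esub> y \<longleftrightarrow> x - y \<in> I"
proof
  assume "I #>\<^bsub>free_Abelian_group S\<^esub> x = I #>\<^bsub>free_Abelian_group S\<^esub> y"
  then have "x \<in> (\<lambda>i. i + y) ` I"
    unfolding frag_coset using assms(1) by (metis add_0 image_eqI)
  then show "x - y \<in> I" by auto
next
  assume d: "x - y \<in> I"
  have neg: "- z \<in> I" if "z \<in> I" for z using assms(2)[OF assms(1) that] by simp
  have add: "z + w \<in> I" if "z \<in> I" "w \<in> I" for z w
    using assms(2)[OF that(1) neg[OF that(2)]] by simp
  have "i + x \<in> (\<lambda>i. i + y) ` I" if "i \<in> I" for i
    by (rule image_eqI[where x = "i + (x - y)"]) (use add[OF that d] in auto)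
  moreover have "i + y \<in> (\<lambda>i. i + x) ` I" if "i \<in> I" for i
    by (rule image_eqI[where x = "i - (x - y)"]) (use assms(2)[OF that d] in auto)
  ultimately show "I #>\<^bsub>free_Abelian_group S\<^esub> x = I #>\<^bsub>free_Abelian_group S\<^esub> y"
    unfolding frag_coset by blast
qed

lemma generate_frag_of:
  assumes "W \<subseteq> S"
  shows "generate (free_Abelian_group S) (frag_of ` W) = {x. Poly_Mapping.keys x \<subseteq> W}"
proof
  interpret group "free_Abelian_group S" by simp
  have sub: "frag_of ` W \<subseteq> carrier (free_Abelian_group S)" using assms by auto
  show "generate (free_Abelian_group S) (frag_of ` W) \<subseteq> {x. Poly_Mapping.keys x \<subseteq> W}"
  proof
    fix x assume "x \<in> generate (free_Abelian_group S) (frag_of ` W)"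
    then show "x \<in> {x. Poly_Mapping.keys x \<subseteq> W}"
    proof induction
      case (inv h)
      then obtain w where w: "w \<in> W" "h = frag_of w" by auto
      have "inv\<^bsub>free_Abelian_group S\<^esub> h = - h"
        by (rule inv_free_Abelian_group) (use w assms in auto)
      then show ?case using w by simp
    qed (use keys_add in \<open>fastforce simp: keys_frag_of\<close>)+
  qed
  have "Poly_Mapping.keys x \<subseteq> W \<Longrightarrow>
      x \<in> generate (free_Abelian_group S) (frag_of ` W)" for x
  proof (induction x rule: frag_induction)
    case zero
    show ?case using generate.one[of "free_Abelian_group S"] by simp
  next
    case (one w)
    then show ?case by (simp add: generate.incl)
  next
    case (diff a b)
    have b: "Poly_Mapping.keys b \<subseteq> S"
      using generate_in_carrier[OF sub diff(2)] by simp
    have "inv\<^bsub>free_Abelian_group S\<^esub> b \<in> generate (free_Abelian_group S) (frag_of ` W)"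
      using generate_m_inv_closed[OF sub diff(2)] .
    then have "- b \<in> generate (free_Abelian_group S) (frag_of ` W)"
      using inv_free_Abelian_group[OF b] by simp
    then show ?case
      using generate.eng[OF diff(1), of "- b"] by simp
  qed
  then show "{x. Poly_Mapping.keys x \<subseteq> W} \<subseteq> generate (free_Abelian_group S) (frag_of ` W)"
    by blast
qed

lemma br_diff_left: "br (x - y) z = br x z - br y z"
  and br_add_left: "br (x + y) z = br x z + br y z"
  and br_minus_left: "br (- x) z = - br x z"
  by (simp_all add: br_def frag_extend_diff frag_extend_add frag_extend_minus)

lemma frag_extend_fun_diff:
  "frag_extend (\<lambda>u. f u - g u) x = frag_extend f x - frag_extend g x"
  by (rule frag_eqI[where S = UNIV]) (simp_all add: frag_extend_diff)

lemma br_diff_right: "br z (x - y) = br z x - br z y"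
  by (simp add: br_def frag_extend_diff frag_extend_fun_diff)

lemma br_zero [simp]: "br 0 x = 0" "br x 0 = 0"
  using br_diff_right[of x 0 0] by (simp_all add: br_def)

lemma br_minus_right: "br z (- x) = - br z x"
  using br_diff_right[of z 0 x] by simp

lemma br_add_right: "br z (x + y) = br z x + br z y"
  using br_diff_right[of z x "- y"] by (simp add: br_minus_right)

lemma br_frag_of [simp]: "br (frag_of u) (frag_of v) = frag_of (Br u v)"
  by (simp add: br_def)

lemma br_keys:
  assumes "Poly_Mapping.keys x \<subseteq> U" "Poly_Mapping.keys y \<subseteq> V"
    and "\<And>u v. u \<in> U \<Longrightarrow> v \<in> V \<Longrightarrow> Br u v \<in> W"
  shows "Poly_Mapping.keys (br x y) \<subseteq> W"
proof
  fix w assume "w \<in> Poly_Mapping.keys (br x y)"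
  then obtain u where u: "u \<in> Poly_Mapping.keys x"
      "w \<in> Poly_Mapping.keys (frag_extend (\<lambda>v. frag_of (Br u v)) y)"
    unfolding br_def using keys_frag_extend by fastforce
  then obtain v where "v \<in> Poly_Mapping.keys y" "w \<in> Poly_Mapping.keys (frag_of (Br u v))"
    using keys_frag_extend by fastforce
  then show "w \<in> W" using u assms by auto
qed

lemma Br_in_lie_words [simp]: "Br u v \<in> lie_words H \<longleftrightarrow> u \<in> lie_words H \<and> v \<in> lie_words H"
  by (auto simp: lie_words_def)

lemma Gen_in_lie_words [simp]: "Gen h \<in> lie_words H \<longleftrightarrow> h \<in> carrier H"
  by (auto simp: lie_words_def)

lemma br_closed:
  assumes "x \<in> carrier (nonassoc H)" "y \<in> carrier (nonassoc H)"
  shows "br x y \<in> carrier (nonassoc H)"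
  using assms br_keys[of x "lie_words H" y "lie_words H" "lie_words H"] by simp

lemma frag_add_closed:
  "x \<in> carrier (free_Abelian_group S) \<Longrightarrow> y \<in> carrier (free_Abelian_group S)
    \<Longrightarrow> x + y \<in> carrier (free_Abelian_group S)"
  using keys_add[of x y] by auto

lemma frag_diff_closed:
  "x \<in> carrier (free_Abelian_group S) \<Longrightarrow> y \<in> carrier (free_Abelian_group S)
    \<Longrightarrow> x - y \<in> carrier (free_Abelian_group S)"
  using keys_diff[of x y] by auto

lemma quasi_lie_relators_subset:
  assumes "monoid H"
  shows "quasi_lie_relators H \<subseteq> carrier (nonassoc H)"
proof -
  interpret monoid H by fact
  have "Gen a \<in> lie_words H \<Longrightarrow> frag_of (Gen a) \<in> carrier (nonassoc H)" for a
    by simp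
  then show ?thesis
    unfolding quasi_lie_relators_def
    by (auto simp del: carrier_free_Abelian_group_iff
        intro!: frag_add_closed frag_diff_closed br_closed)
qed

lemma lie_relators_subset:
  assumes "monoid H"
  shows "lie_relators H \<subseteq> carrier (nonassoc H)"
  unfolding lie_relators_def
  using quasi_lie_relators_subset[OF assms] br_closed[of _ H] by blast

lemma nonassoc_ideal_subset:
  assumes "R \<subseteq> carrier (nonassoc H)"
  shows "nonassoc_ideal H R \<subseteq> carrier (nonassoc H)"
proof
  fix x assume "x \<in> nonassoc_ideal H R"
  then show "x \<in> carrier (nonassoc H)"
  proof induction
    case zero
    show ?case by simp
  qed (use assms in \<open>auto simp del: carrier_free_Abelian_group_iff
        intro: frag_diff_closed br_closed\<close>)
qed

lemma nonassoc_ideal_mono: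
  assumes "R \<subseteq> R'"
  shows "nonassoc_ideal H R \<subseteq> nonassoc_ideal H R'"
proof
  fix x assume "x \<in> nonassoc_ideal H R"
  then show "x \<in> nonassoc_ideal H R'"
    by induction (use assms in \<open>auto intro: nonassoc_ideal.intros\<close>)
qed

lemma nonassoc_ideal_minus: "x \<in> nonassoc_ideal H R \<Longrightarrow> - x \<in> nonassoc_ideal H R"
  using nonassoc_ideal.diff[OF nonassoc_ideal.zero] by fastforce

lemma nonassoc_ideal_add:
  "x \<in> nonassoc_ideal H R \<Longrightarrow> y \<in> nonassoc_ideal H R \<Longrightarrow> x + y \<in> nonassoc_ideal H R"
  using nonassoc_ideal.diff[OF _ nonassoc_ideal_minus] by fastforce

lemma nonassoc_coset_eq:
  "nonassoc_ideal H R #>\<^bsub>nonassoc H\<^esub> x = nonassoc_ideal H R #>\<^bsub>nonassoc H\<^esub> y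
    \<longleftrightarrow> x - y \<in> nonassoc_ideal H R"
  by (rule frag_coset_eq) (auto intro: nonassoc_ideal.intros)

lemma nonassoc_ideal_normal:
  assumes "R \<subseteq> carrier (nonassoc H)"
  shows "nonassoc_ideal H R \<lhd> nonassoc H"
proof -
  have sub: "\<And>x. x \<in> nonassoc_ideal H R \<Longrightarrow> Poly_Mapping.keys x \<subseteq> lie_words H"
    using nonassoc_ideal_subset[OF assms] by (meson carrier_free_Abelian_group_iff subsetD)
  interpret comm_group "nonassoc H" by (rule abelian_free_Abelian_group)
  have "subgroup (nonassoc_ideal H R) (nonassoc H)"
    by unfold_locales
      (use sub in \<open>auto simp: nonassoc_ideal.zero nonassoc_ideal_minus nonassoc_ideal_add\<close>)
  then show ?thesis by (rule subgroup_imp_normal)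
qed

context
  fixes H :: "('h, 'm) monoid_scheme" and R
  assumes R: "R \<subseteq> carrier (nonassoc H)"
begin

private abbreviation (input) "I \<equiv> nonassoc_ideal H R"
private abbreviation (input) "Q \<equiv> nonassoc_quot H I"
private abbreviation (input) "cl x \<equiv> I #>\<^bsub>nonassoc H\<^esub> x"

lemma carrier_nonassoc_quot: "carrier Q = cl ` carrier (nonassoc H)"
  by (simp add: nonassoc_quot_def carrier_FactGroup)

lemma one_nonassoc_quot: "\<one>\<^bsub>Q\<^esub> = cl 0"
  by (auto simp: nonassoc_quot_def frag_coset)

lemma mult_nonassoc_quot:
  assumes "x \<in> carrier (nonassoc H)" "y \<in> carrier (nonassoc H)"
  shows "cl x \<otimes>\<^bsub>Q\<^esub> cl y = cl (x + y)"
  using normal.rcos_sum[OF nonassoc_ideal_normal[OF R] assms]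
  by (simp add: nonassoc_quot_def)

lemma bracket_nonassoc_quot:
  assumes "x \<in> carrier (nonassoc H)" "y \<in> carrier (nonassoc H)"
  shows "bracket Q (cl x) (cl y) = cl (br x y)"
proof -
  have eq: "cl (br (i + x) (j + y)) = cl (br x y)" if "i \<in> I" "j \<in> I" for i j
  proof -
    have "j \<in> carrier (nonassoc H)" using nonassoc_ideal_subset[OF R] that by blast
    then have "br i (j + y) \<in> I" "br x j \<in> I"
      using that assms frag_add_closed by (blast intro: nonassoc_ideal.intros)+
    then have "br i (j + y) + br x j \<in> I" by (rule nonassoc_ideal_add)
    then show ?thesis
      unfolding nonassoc_coset_eq by (simp add: br_add_left br_add_right algebra_simps)
  qed
  have "bracket Q (cl x) (cl y) = (\<Union>i\<in>I. \<Union>j\<in>I. cl (br (i + x) (j + y)))"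
    by (simp add: nonassoc_quot_def frag_coset)
  also have "\<dots> = cl (br x y)"
    using eq nonassoc_ideal.zero by fast
  finally show ?thesis .
qed

lemma comm_group_nonassoc_quot: "comm_group Q"
proof -
  interpret comm_group "nonassoc H" by (rule abelian_free_Abelian_group)
  have "comm_group (nonassoc H Mod I)"
    by (rule abelian_FactGroup) (use nonassoc_ideal_normal[OF R] normal_imp_subgroup in blast)
  then interpret K: comm_group "nonassoc H Mod I" .
  have "\<exists>y \<in> carrier Q. y \<otimes>\<^bsub>Q\<^esub> x = \<one>\<^bsub>Q\<^esub>" if "x \<in> carrier Q" for x
    using K.l_inv_ex[of x] that by (auto simp: nonassoc_quot_def)
  then show ?thesis
    by (intro comm_groupI)
      (use K.m_closed K.m_assoc K.m_comm K.l_one K.one_closed in \<open>simp_all add: nonassoc_quot_def\<close>)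
qed

lemma nonassoc_quot_hom: "cl \<in> hom (nonassoc H) Q"
  by (rule homI) (auto simp: carrier_nonassoc_quot mult_nonassoc_quot)

lemma quasi_lie_algebra_nonassoc_quot:
  assumes "quasi_lie_relators H \<subseteq> R"
  shows "quasi_lie_algebra Q"
proof -
  interpret comm_group Q by (rule comm_group_nonassoc_quot)
  have rel: "z \<in> quasi_lie_relators H \<Longrightarrow> cl z = cl 0" for z
    unfolding nonassoc_coset_eq using assms by (auto intro: nonassoc_ideal.base)
  have brc: "\<And>x y. x \<in> carrier (nonassoc H) \<Longrightarrow> y \<in> carrier (nonassoc H)
     \<Longrightarrow> br x y \<in> carrier (nonassoc H)"
    by (rule br_closed)
  have addc: "\<And>x y. x \<in> carrier (nonassoc H) \<Longrightarrow> y \<in> carrier (nonassoc H)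
     \<Longrightarrow> x + y \<in> carrier (nonassoc H)"
    by (rule frag_add_closed)
  note ops = mult_nonassoc_quot bracket_nonassoc_quot one_nonassoc_quot brc addc
  show ?thesis
  proof unfold_locales
    fix u v assume "u \<in> carrier Q" "v \<in> carrier Q"
    then obtain x y where xy: "x \<in> carrier (nonassoc H)" "y \<in> carrier (nonassoc H)"
        "u = cl x" "v = cl y"
      by (auto simp: carrier_nonassoc_quot simp del: carrier_free_Abelian_group_iff)
    show "bracket Q u v \<in> carrier Q"
      using xy brc by (simp add: bracket_nonassoc_quot carrier_nonassoc_quot
          del: carrier_free_Abelian_group_iff)
    have "br x y + br y x \<in> quasi_lie_relators H"
      unfolding quasi_lie_relators_def using xy by blast
    then show "bracket Q u v \<otimes>\<^bsub>Q\<^esub> bracket Q v u = \<one>\<^bsub>Q\<^esub>"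
      using xy rel by (simp add: ops del: carrier_free_Abelian_group_iff)
    fix t assume "t \<in> carrier Q"
    then obtain z where z: "z \<in> carrier (nonassoc H)" "t = cl z"
      by (auto simp: carrier_nonassoc_quot simp del: carrier_free_Abelian_group_iff)
    show "bracket Q (u \<otimes>\<^bsub>Q\<^esub> v) t = bracket Q u t \<otimes>\<^bsub>Q\<^esub> bracket Q v t"
      "bracket Q t (u \<otimes>\<^bsub>Q\<^esub> v) = bracket Q t u \<otimes>\<^bsub>Q\<^esub> bracket Q t v"
      using xy z by (simp_all add: ops br_add_left br_add_right
          del: carrier_free_Abelian_group_iff)
    have "br (br x y) z + br (br y z) x + br (br z x) y \<in> quasi_lie_relators H"
      unfolding quasi_lie_relators_def using xy z by blast
    then show "bracket Q (bracket Q u v) t \<otimes>\<^bsub>Q\<^esub> bracket Q (bracket Q v t) u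
        \<otimes>\<^bsub>Q\<^esub> bracket Q (bracket Q t u) v = \<one>\<^bsub>Q\<^esub>"
      using xy z rel by (simp add: ops del: carrier_free_Abelian_group_iff)
  qed
qed

lemma gen_mult_nonassoc_quot:
  assumes "quasi_lie_relators H \<subseteq> R" "a \<in> carrier H" "b \<in> carrier H"
  shows "cl (frag_of (Gen (a \<otimes>\<^bsub>H\<^esub> b))) = cl (frag_of (Gen a)) \<otimes>\<^bsub>Q\<^esub> cl (frag_of (Gen b))"
proof -
  have "frag_of (Gen (a \<otimes>\<^bsub>H\<^esub> b)) - (frag_of (Gen a) + frag_of (Gen b)) \<in> quasi_lie_relators H"
    unfolding quasi_lie_relators_def using assms by blast
  then have "frag_of (Gen (a \<otimes>\<^bsub>H\<^esub> b)) - (frag_of (Gen a) + frag_of (Gen b)) \<in> I"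
    using assms by (auto intro: nonassoc_ideal.base)
  then have "cl (frag_of (Gen (a \<otimes>\<^bsub>H\<^esub> b))) = cl (frag_of (Gen a) + frag_of (Gen b))"
    unfolding nonassoc_coset_eq .
  then show ?thesis using assms by (simp add: mult_nonassoc_quot)
qed

lemma nonassoc_quot_part:
  "carrier (subgroup_generated Q ((\<lambda>w. cl (frag_of w)) ` {w \<in> lie_words H. weight w = n}))
     = cl ` {x. Poly_Mapping.keys x \<subseteq> {w \<in> lie_words H. weight w = n}}"
proof -
  let ?W = "{w \<in> lie_words H. weight w = n}"
  interpret group_hom "nonassoc H" Q cl
    using comm_group_nonassoc_quot nonassoc_quot_hom
    by (simp add: group_hom_def group_hom_axioms_def comm_group_def)
  have "carrier Q \<inter> (\<lambda>w. cl (frag_of w)) ` ?W = cl ` (frag_of ` ?W)"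
    by (auto simp: carrier_nonassoc_quot image_iff)
  moreover have "frag_of ` ?W \<subseteq> carrier (nonassoc H)" by auto
  note generate_img[OF this]
  moreover have "generate (nonassoc H) (frag_of ` ?W) = {x. Poly_Mapping.keys x \<subseteq> ?W}"
    by (rule generate_frag_of) auto
  ultimately show ?thesis by (simp only: carrier_subgroup_generated)
qed

end


section \<open>Universal properties\<close>

lemmas frag_induct [consumes 1, case_names zero diff gen] = free_Abelian_group_induct

primrec word_eval :: "('a, 'n) lie_ring_scheme \<Rightarrow> ('h \<Rightarrow> 'a) \<Rightarrow> 'h lie_word \<Rightarrow> 'a" where
  "word_eval M f (Gen h) = f h"
| "word_eval M f (Br u v) = bracket M (word_eval M f u) (word_eval M f v)"

context quasi_lie_algebra
begin

lemma bracket_one_left: "x \<in> carrier L \<Longrightarrow> bracket L \<one> x = \<one>"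
  using bracket_mult_left[of \<one> \<one> x] bracket_closed[of \<one> x] by simp

lemma bracket_one_right: "x \<in> carrier L \<Longrightarrow> bracket L x \<one> = \<one>"
  using bracket_mult_right[of \<one> \<one> x] bracket_closed[of x \<one>] by simp

lemma bracket_inv_left:
  assumes "x \<in> carrier L" "y \<in> carrier L"
  shows "bracket L (inv x) y = inv (bracket L x y)"
  using bracket_mult_left[of "inv x" x y] bracket_closed assms
  by (simp add: bracket_one_left inv_equality)

lemma bracket_inv_right:
  assumes "x \<in> carrier L" "y \<in> carrier L"
  shows "bracket L y (inv x) = inv (bracket L y x)"
  using bracket_mult_right[of "inv x" x y] bracket_closed assms
  by (simp add: bracket_one_right inv_equality)

lemma hom_frag_diff_quot:
  assumes "g \<in> hom (free_Abelian_group S) L"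
    and "x \<in> carrier (free_Abelian_group S)" "y \<in> carrier (free_Abelian_group S)"
  shows "g (x - y) = g x \<otimes> inv (g y)"
proof -
  interpret g: group_hom "free_Abelian_group S" L g
    using assms by (simp add: group_hom_def group_hom_axioms_def)
  have "g (x - y) = g (x \<otimes>\<^bsub>free_Abelian_group S\<^esub> inv\<^bsub>free_Abelian_group S\<^esub> y)"
    using assms by simp
  also have "\<dots> = g x \<otimes> inv (g y)"
    using assms g.hom_mult g.hom_inv g.G.inv_closed by presburger
  finally show ?thesis .
qed

lemma hom_br:
  assumes g: "g \<in> hom (nonassoc H) L"
    and gw: "\<And>w. w \<in> lie_words H \<Longrightarrow> g (frag_of w) = word_eval L f w"
    and x: "x \<in> carrier (nonassoc H)" and y: "y \<in> carrier (nonassoc H)"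
  shows "g (br x y) = bracket L (g x) (g y)"
proof -
  interpret g: group_hom "nonassoc H" L g
    using g by (simp add: group_hom_def group_hom_axioms_def)
  note d = hom_frag_diff_quot[OF g]
  have g0: "g 0 = \<one>" using g.hom_one by simp
  have gc: "Poly_Mapping.keys z \<subseteq> lie_words H \<Longrightarrow> g z \<in> carrier L" for z
    using g.hom_closed by simp
  have 1: "g (br (frag_of u) y) = bracket L (g (frag_of u)) (g y)"
    if u: "u \<in> lie_words H" for u
  proof -
    have "Poly_Mapping.keys y \<subseteq> lie_words H" using y by simp
    then show ?thesis
    proof (induction y rule: frag_induct)
      case zero
      show ?case using gc[of "frag_of u"] u by (simp add: g0 bracket_one_right)
    next
      case (diff a b)
      have "br (frag_of u) a \<in> carrier (nonassoc H)" "br (frag_of u) b \<in> carrier (nonassoc H)"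
        using u diff by (auto simp del: carrier_free_Abelian_group_iff intro!: br_closed)
          (simp_all add: u diff)
      then show ?case
        using diff u gc[of "frag_of u"] gc[of a] gc[of b]
        by (simp add: br_diff_right d bracket_mult_right bracket_inv_right)
    next
      case (gen v)
      then show ?case using u gw[of u] gw[of v] gw[of "Br u v"] by simp
    qed
  qed
  have "Poly_Mapping.keys x \<subseteq> lie_words H" using x by simp
  then show ?thesis
  proof (induction x rule: frag_induct)
    case zero
    show ?case using gc[of y] y by (simp add: g0 bracket_one_left)
  next
    case (diff a b)
    have "br a y \<in> carrier (nonassoc H)" "br b y \<in> carrier (nonassoc H)"
      by (rule br_closed; use diff y in simp)+
    then show ?case
      using diff y gc[of y] gc[of a] gc[of b]
      by (simp add: br_diff_left d bracket_mult_left bracket_inv_left)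
  next
    case (gen u)
    then show ?case using 1 by simp
  qed
qed

lemma word_eval_closed:
  assumes "f \<in> carrier H \<rightarrow> carrier L"
  shows "w \<in> lie_words H \<Longrightarrow> word_eval L f w \<in> carrier L"
  by (induction w) (use assms bracket_closed in auto)

lemma nonassoc_ideal_vanish:
  assumes g: "g \<in> hom (nonassoc H) L"
    and gw: "\<And>w. w \<in> lie_words H \<Longrightarrow> g (frag_of w) = word_eval L f w"
    and R: "R \<subseteq> carrier (nonassoc H)" "\<And>r. r \<in> R \<Longrightarrow> g r = \<one>"
    and x: "x \<in> nonassoc_ideal H R"
  shows "g x = \<one>"
proof -
  interpret g: group_hom "nonassoc H" L g
    using g by (simp add: group_hom_def group_hom_axioms_def)
  have sub: "\<And>x. x \<in> nonassoc_ideal H R \<Longrightarrow> x \<in> carrier (nonassoc H)"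
    using nonassoc_ideal_subset[OF R(1)] by blast
  show ?thesis
    using x
  proof induction
    case zero
    show ?case using g.hom_one by simp
  next
    case (diff x y)
    then show ?case using hom_frag_diff_quot[OF g] sub by simp
  next
    case (left x y)
    then show ?case
      using hom_br[OF g gw] sub g.hom_closed by (simp add: bracket_one_right)
  next
    case (right x y)
    then show ?case
      using hom_br[OF g gw] sub g.hom_closed by (simp add: bracket_one_left)
  qed (use R in auto)
qed

lemma quasi_lie_relators_vanish:
  assumes g: "g \<in> hom (nonassoc H) L"
    and gw: "\<And>w. w \<in> lie_words H \<Longrightarrow> g (frag_of w) = word_eval L f w"
    and f: "f \<in> hom H L" and "monoid H"
    and r: "r \<in> quasi_lie_relators H"
  shows "g r = \<one>"
proof -
  interpret g: group_hom "nonassoc H" L g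
    using g by (simp add: group_hom_def group_hom_axioms_def)
  interpret H: monoid H by fact
  note br = hom_br[OF g gw]
  have add: "\<And>x y. x \<in> carrier (nonassoc H) \<Longrightarrow> y \<in> carrier (nonassoc H)
      \<Longrightarrow> g (x + y) = g x \<otimes> g y"
    using g.hom_mult by simp
  from r consider
      (gen) a b where "a \<in> carrier H" "b \<in> carrier H"
        "r = frag_of (Gen (a \<otimes>\<^bsub>H\<^esub> b)) - (frag_of (Gen a) + frag_of (Gen b))"
    | (anti) x y where "x \<in> carrier (nonassoc H)" "y \<in> carrier (nonassoc H)"
        "r = br x y + br y x"
    | (jac) x y z where "x \<in> carrier (nonassoc H)" "y \<in> carrier (nonassoc H)"
        "z \<in> carrier (nonassoc H)" "r = br (br x y) z + br (br y z) x + br (br z x) y"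
    unfolding quasi_lie_relators_def by blast
  then show ?thesis
  proof cases
    case gen
    have c: "frag_of (Gen (a \<otimes>\<^bsub>H\<^esub> b)) \<in> carrier (nonassoc H)"
        "frag_of (Gen a) \<in> carrier (nonassoc H)" "frag_of (Gen b) \<in> carrier (nonassoc H)"
      using gen by auto
    have "g r = f (a \<otimes>\<^bsub>H\<^esub> b) \<otimes> inv (f a \<otimes> f b)"
      using gen(1,2) c frag_add_closed[OF c(2,3)] unfolding gen(3)
      by (simp add: hom_frag_diff_quot[OF g] add gw del: carrier_free_Abelian_group_iff)
    also have "\<dots> = \<one>"
      using gen f hom_mult[OF f] hom_in_carrier[OF f] by simp
    finally show ?thesis .
  next
    case anti
    then show ?thesis
      using br_closed[of _ H] g.hom_closed
      by (simp add: add br bracket_antisym del: carrier_free_Abelian_group_iff)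
  next
    case jac
    then show ?thesis
      using br_closed[of _ H] frag_add_closed[where S = "lie_words H"] g.hom_closed
      by (simp add: add br jacobi del: carrier_free_Abelian_group_iff)
  qed
qed

lemma nonassoc_quot_universal:
  assumes f: "f \<in> hom H L" and "monoid H"
    and R: "R \<subseteq> carrier (nonassoc H)"
    and van: "\<And>g r. \<lbrakk>g \<in> hom (nonassoc H) L;
        \<And>w. w \<in> lie_words H \<Longrightarrow> g (frag_of w) = word_eval L f w; r \<in> R\<rbrakk> \<Longrightarrow> g r = \<one>"
  shows "\<exists>g \<in> lie_hom (nonassoc_quot H (nonassoc_ideal H R)) L.
     \<forall>h \<in> carrier H. g (nonassoc_ideal H R #>\<^bsub>nonassoc H\<^esub> frag_of (Gen h)) = f h"
proof -
  let ?I = "nonassoc_ideal H R"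
  let ?Q = "nonassoc_quot H ?I"
  have "word_eval L f ` lie_words H \<subseteq> carrier L"
    using word_eval_closed[of f H] hom_in_carrier[OF f] by blast
  then obtain g where g: "g \<in> hom (nonassoc H) L"
    and gw: "\<And>w. w \<in> lie_words H \<Longrightarrow> g (frag_of w) = word_eval L f w"
    using free_Abelian_group_universal by metis
  interpret g: group_hom "nonassoc H" L g
    using g by (simp add: group_hom_def group_hom_axioms_def)
  have van': "x \<in> ?I \<Longrightarrow> g x = \<one>" for x
    using nonassoc_ideal_vanish[OF g gw R] van[OF g gw] by blast
  have inj: "g x = g y" if "x \<in> carrier (nonassoc H)" "y \<in> carrier (nonassoc H)"
      "?I #>\<^bsub>nonassoc H\<^esub> x = ?I #>\<^bsub>nonassoc H\<^esub> y" for x y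
  proof -
    have "g (x - y) = \<one>" using that(3) van' unfolding nonassoc_coset_eq by blast
    then have "g x \<otimes> inv (g y) = \<one>" using hom_frag_diff_quot[OF g that(1,2)] by simp
    then show ?thesis using that g.hom_closed by (metis inv_equality inv_inv g.hom_closed inv_closed)
  qed
  obtain k where k: "k \<in> hom (nonassoc H Mod ?I) L"
      "\<And>x. x \<in> carrier (nonassoc H) \<Longrightarrow> k (?I #>\<^bsub>nonassoc H\<^esub> x) = g x"
    using FactGroup_universal[OF g nonassoc_ideal_normal[OF R] inj] by metis
  have "k \<in> hom ?Q L"
    using k(1) by (simp add: hom_def nonassoc_quot_def)
  moreover have "k (bracket ?Q U V) = bracket L (k U) (k V)"
    if "U \<in> carrier ?Q" "V \<in> carrier ?Q" for U V
  proof -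
    obtain x y where xy: "x \<in> carrier (nonassoc H)" "y \<in> carrier (nonassoc H)"
        "U = ?I #>\<^bsub>nonassoc H\<^esub> x" "V = ?I #>\<^bsub>nonassoc H\<^esub> y"
      using \<open>U \<in> carrier ?Q\<close> \<open>V \<in> carrier ?Q\<close> unfolding carrier_nonassoc_quot[OF R] by blast
    then show ?thesis
      using k(2) br_closed[OF xy(1,2)] hom_br[OF g gw xy(1,2)]
      by (simp add: bracket_nonassoc_quot[OF R] del: carrier_free_Abelian_group_iff)
  qed
  moreover have "k (?I #>\<^bsub>nonassoc H\<^esub> frag_of (Gen h)) = f h" if "h \<in> carrier H" for h
    using k(2)[of "frag_of (Gen h)"] gw[of "Gen h"] that by simp
  ultimately show ?thesis unfolding lie_hom_def by blast
qed

end

lemma lie_hom_nonassoc_quot_unique: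
  assumes R: "R \<subseteq> carrier (nonassoc H)"
    and M: "group M"
    and g: "g \<in> lie_hom (nonassoc_quot H (nonassoc_ideal H R)) M"
    and g': "g' \<in> lie_hom (nonassoc_quot H (nonassoc_ideal H R)) M"
    and eq: "\<And>h. h \<in> carrier H \<Longrightarrow>
        g (nonassoc_ideal H R #>\<^bsub>nonassoc H\<^esub> frag_of (Gen h))
          = g' (nonassoc_ideal H R #>\<^bsub>nonassoc H\<^esub> frag_of (Gen h))"
    and U: "U \<in> carrier (nonassoc_quot H (nonassoc_ideal H R))"
  shows "g U = g' U"
proof -
  let ?I = "nonassoc_ideal H R"
  let ?Q = "nonassoc_quot H ?I"
  let ?cl = "\<lambda>x. ?I #>\<^bsub>nonassoc H\<^esub> x"
  have w: "w \<in> lie_words H \<Longrightarrow> g (?cl (frag_of w)) = g' (?cl (frag_of w))" for w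
  proof (induction w)
    case (Gen h)
    then show ?case using eq by simp
  next
    case (Br u v)
    have c: "frag_of u \<in> carrier (nonassoc H)" "frag_of v \<in> carrier (nonassoc H)"
      using Br by auto
    have "?cl (frag_of (Br u v)) = bracket ?Q (?cl (frag_of u)) (?cl (frag_of v))"
      using bracket_nonassoc_quot[OF R c] by simp
    moreover have "?cl (frag_of u) \<in> carrier ?Q" "?cl (frag_of v) \<in> carrier ?Q"
      unfolding carrier_nonassoc_quot[OF R] using c by blast+
    ultimately show ?case using g g' Br by (simp add: lie_hom_def)
  qed
  have "group ?Q" using comm_group_nonassoc_quot[OF R] by (simp add: comm_group_def)
  then have hom: "group_hom (nonassoc H) M (k \<circ> ?cl)"
    if "k \<in> lie_hom ?Q M" for k
    by (intro group_hom.intro group_hom_axioms.intro hom_compose[OF nonassoc_quot_hom[OF R]] M)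
      (use that in \<open>simp_all add: lie_hom_def\<close>)
  obtain x where x: "Poly_Mapping.keys x \<subseteq> lie_words H" "U = ?cl x"
    using U unfolding carrier_nonassoc_quot[OF R] by auto
  interpret M: group M by fact
  interpret g: group_hom "nonassoc H" M "g \<circ> ?cl" using hom[OF g] .
  interpret g': group_hom "nonassoc H" M "g' \<circ> ?cl" using hom[OF g'] .
  have "(g \<circ> ?cl) x = (g' \<circ> ?cl) x"
    using x(1)
  proof (induction x rule: frag_induct)
    case zero
    show ?case using g.hom_one g'.hom_one by simp
  next
    case (diff a b)
    have c: "a \<in> carrier (nonassoc H)" "b \<in> carrier (nonassoc H)" using diff by auto
    have "a - b = a \<otimes>\<^bsub>nonassoc H\<^esub> inv\<^bsub>nonassoc H\<^esub> b" using diff by simp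
    then show ?case
      using diff c g.hom_mult g'.hom_mult g.hom_inv g'.hom_inv g.G.inv_closed by metis
  next
    case (gen u)
    then show ?case using w by simp
  qed
  then show ?thesis using x by simp
qed

lemma quasi_lie_algebra_free_quasi_lie:
  assumes "monoid H"
  shows "quasi_lie_algebra (free_quasi_lie H)"
  unfolding free_quasi_lie_def
  by (rule quasi_lie_algebra_nonassoc_quot[OF quasi_lie_relators_subset[OF assms]]) simp

lemma lie_algebra_free_lie:
  assumes "monoid H"
  shows "lie_algebra (free_lie H)"
proof -
  note R = lie_relators_subset[OF assms]
  interpret quasi_lie_algebra "free_lie H"
    unfolding free_lie_def
    by (rule quasi_lie_algebra_nonassoc_quot[OF R]) (simp add: lie_relators_def)
  show ?thesis
  proof unfold_locales
    fix U assume "U \<in> carrier (free_lie H)"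
    then obtain x where x: "x \<in> carrier (nonassoc H)"
        "U = nonassoc_ideal H (lie_relators H) #>\<^bsub>nonassoc H\<^esub> x"
      unfolding free_lie_def carrier_nonassoc_quot[OF R] by blast
    then have "br x x \<in> nonassoc_ideal H (lie_relators H)"
      unfolding lie_relators_def by (blast intro: nonassoc_ideal.base)
    then have "nonassoc_ideal H (lie_relators H) #>\<^bsub>nonassoc H\<^esub> br x x
        = nonassoc_ideal H (lie_relators H) #>\<^bsub>nonassoc H\<^esub> 0"
      unfolding nonassoc_coset_eq by simp
    then show "bracket (free_lie H) U U = \<one>\<^bsub>free_lie H\<^esub>"
      using x by (simp add: free_lie_def bracket_nonassoc_quot[OF R] one_nonassoc_quot[OF R]
          del: carrier_free_Abelian_group_iff)
  qed
qed

lemma quasi_lie_gen_hom: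
  assumes "monoid H"
  shows "quasi_lie_gen H \<in> hom H (free_quasi_lie H)"
proof -
  note R = quasi_lie_relators_subset[OF assms]
  show ?thesis
    by (rule homI) (simp_all add: free_quasi_lie_def quasi_lie_gen_def
        carrier_nonassoc_quot[OF R] gen_mult_nonassoc_quot[OF R])
qed

lemma lie_gen_hom:
  assumes "monoid H"
  shows "lie_gen H \<in> hom H (free_lie H)"
proof -
  note R = lie_relators_subset[OF assms]
  have sub: "quasi_lie_relators H \<subseteq> lie_relators H" by (simp add: lie_relators_def)
  show ?thesis
    by (rule homI) (simp_all add: free_lie_def lie_gen_def
        carrier_nonassoc_quot[OF R] gen_mult_nonassoc_quot[OF R sub])
qed

theorem free_quasi_lie_universal:
  assumes "monoid H" "quasi_lie_algebra M" "f \<in> hom H M"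
  shows "\<exists>!g. g \<in> extensional (carrier (free_quasi_lie H)) \<and> g \<in> lie_hom (free_quasi_lie H) M
           \<and> (\<forall>h \<in> carrier H. g (quasi_lie_gen H h) = f h)"
proof -
  note R = quasi_lie_relators_subset[OF assms(1)]
  interpret M: quasi_lie_algebra M by fact
  interpret Q: quasi_lie_algebra "free_quasi_lie H"
    by (rule quasi_lie_algebra_free_quasi_lie[OF assms(1)])
  have "\<exists>g \<in> lie_hom (free_quasi_lie H) M. \<forall>h \<in> carrier H. g (quasi_lie_gen H h) = f h"
    unfolding free_quasi_lie_def quasi_lie_gen_def
    by (rule M.nonassoc_quot_universal[OF assms(3,1) R])
      (rule M.quasi_lie_relators_vanish[OF _ _ assms(3,1)])
  then obtain g where g: "g \<in> lie_hom (free_quasi_lie H) M"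
      "\<forall>h \<in> carrier H. g (quasi_lie_gen H h) = f h" by blast
  let ?g = "restrict g (carrier (free_quasi_lie H))"
  have "?g \<in> lie_hom (free_quasi_lie H) M"
    using g(1) Q.bracket_closed by (auto simp: lie_hom_def hom_def)
  moreover have "\<forall>h \<in> carrier H. ?g (quasi_lie_gen H h) = f h"
    using g(2) hom_in_carrier[OF quasi_lie_gen_hom[OF assms(1)]] by simp
  moreover have "k = k'"
    if "k \<in> extensional (carrier (free_quasi_lie H))"
      "k' \<in> extensional (carrier (free_quasi_lie H))"
      "k \<in> lie_hom (free_quasi_lie H) M" "k' \<in> lie_hom (free_quasi_lie H) M"
      "\<forall>h \<in> carrier H. k (quasi_lie_gen H h) = f h"
      "\<forall>h \<in> carrier H. k' (quasi_lie_gen H h) = f h" for k k'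
    by (rule extensionalityI[OF that(1,2)])
      (use that(3-6) lie_hom_nonassoc_quot_unique[OF R M.is_group, of k k']
        in \<open>simp add: free_quasi_lie_def quasi_lie_gen_def\<close>)
  ultimately show ?thesis
    by (intro ex1I[of _ ?g]) auto
qed

theorem free_lie_universal:
  assumes "monoid H" "lie_algebra M" "f \<in> hom H M"
  shows "\<exists>!g. g \<in> extensional (carrier (free_lie H)) \<and> g \<in> lie_hom (free_lie H) M
           \<and> (\<forall>h \<in> carrier H. g (lie_gen H h) = f h)"
proof -
  note R = lie_relators_subset[OF assms(1)]
  interpret M: lie_algebra M by fact
  interpret Q: lie_algebra "free_lie H"
    by (rule lie_algebra_free_lie[OF assms(1)])
  have "\<exists>g \<in> lie_hom (free_lie H) M. \<forall>h \<in> carrier H. g (lie_gen H h) = f h"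
    unfolding free_lie_def lie_gen_def
  proof (rule M.nonassoc_quot_universal[OF assms(3,1) R])
    fix g r
    assume g: "g \<in> hom (nonassoc H) M"
      "\<And>w. w \<in> lie_words H \<Longrightarrow> g (frag_of w) = word_eval M f w" and "r \<in> lie_relators H"
    then consider "r \<in> quasi_lie_relators H"
      | x where "x \<in> carrier (nonassoc H)" "r = br x x"
      unfolding lie_relators_def by blast
    then show "g r = \<one>\<^bsub>M\<^esub>"
    proof cases
      case 1
      show ?thesis by (rule M.quasi_lie_relators_vanish[OF g(1) _ assms(3,1) 1]) (rule g(2))
    next
      case 2
      then show ?thesis
        using M.hom_br[OF g 2(1) 2(1)] M.bracket_self hom_in_carrier[OF g(1) 2(1)] by simp
    qed
  qed
  then obtain g where g: "g \<in> lie_hom (free_lie H) M"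
      "\<forall>h \<in> carrier H. g (lie_gen H h) = f h" by blast
  let ?g = "restrict g (carrier (free_lie H))"
  have "?g \<in> lie_hom (free_lie H) M"
    using g(1) Q.bracket_closed by (auto simp: lie_hom_def hom_def)
  moreover have "\<forall>h \<in> carrier H. ?g (lie_gen H h) = f h"
    using g(2) hom_in_carrier[OF lie_gen_hom[OF assms(1)]] by simp
  moreover have "k = k'"
    if "k \<in> extensional (carrier (free_lie H))" "k' \<in> extensional (carrier (free_lie H))"
      "k \<in> lie_hom (free_lie H) M" "k' \<in> lie_hom (free_lie H) M"
      "\<forall>h \<in> carrier H. k (lie_gen H h) = f h" "\<forall>h \<in> carrier H. k' (lie_gen H h) = f h" for k k'
    by (rule extensionalityI[OF that(1,2)])
      (use that(3-6) lie_hom_nonassoc_quot_unique[OF R M.is_group, of k k']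
        in \<open>simp add: free_lie_def lie_gen_def\<close>)
  ultimately show ?thesis
    by (intro ex1I[of _ ?g]) auto
qed


section \<open>Universal property of the tensor product\<close>

lemma tensor_relators_subset:
  assumes "monoid A" "monoid B"
  shows "tensor_relators A B \<subseteq> carrier (free_Abelian_group (carrier A \<times> carrier B))"
proof -
  interpret A: monoid A by fact
  interpret B: monoid B by fact
  have "p \<in> carrier A \<times> carrier B
      \<Longrightarrow> frag_of p \<in> carrier (free_Abelian_group (carrier A \<times> carrier B))" for p
    by simp
  then show ?thesis
    unfolding tensor_relators_def
    by (auto simp del: carrier_free_Abelian_group_iff
        intro!: frag_diff_closed frag_add_closed)
qed

lemma tensor_kernel_normal:
  assumes "monoid A" "monoid B"
  shows "tensor_kernel A B \<lhd> free_Abelian_group (carrier A \<times> carrier B)"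
proof -
  interpret comm_group "free_Abelian_group (carrier A \<times> carrier B)"
    by (rule abelian_free_Abelian_group)
  show ?thesis
    unfolding tensor_kernel_def
    by (intro subgroup_imp_normal generate_is_subgroup tensor_relators_subset assms)
qed

lemma comm_group_tensor:
  assumes "monoid A" "monoid B"
  shows "comm_group (tensor A B)"
proof -
  interpret comm_group "free_Abelian_group (carrier A \<times> carrier B)"
    by (rule abelian_free_Abelian_group)
  show ?thesis
    unfolding tensor_def
    by (rule abelian_FactGroup) (rule normal_imp_subgroup[OF tensor_kernel_normal[OF assms]])
qed

lemma tensor_coset_eq:
  assumes "monoid A" "monoid B"
  shows "tensor_kernel A B #>\<^bsub>free_Abelian_group (carrier A \<times> carrier B)\<^esub> x
       = tensor_kernel A B #>\<^bsub>free_Abelian_group (carrier A \<times> carrier B)\<^esub> y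
     \<longleftrightarrow> x - y \<in> tensor_kernel A B"
proof (rule frag_coset_eq)
  interpret subgroup "tensor_kernel A B" "free_Abelian_group (carrier A \<times> carrier B)"
    using normal_imp_subgroup[OF tensor_kernel_normal[OF assms]] .
  show "0 \<in> tensor_kernel A B" using one_closed by simp
  fix x y assume xy: "x \<in> tensor_kernel A B" "y \<in> tensor_kernel A B"
  then have "Poly_Mapping.keys y \<subseteq> carrier A \<times> carrier B" using mem_carrier by simp
  then have "- y \<in> tensor_kernel A B" using m_inv_closed[OF xy(2)] by simp
  then show "x - y \<in> tensor_kernel A B" using m_closed[OF xy(1), of "- y"] by simp
qed

lemma pure_tensor_closed:
  assumes "a \<in> carrier A" "b \<in> carrier B"
  shows "pure_tensor A B a b \<in> carrier (tensor A B)"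
proof -
  have "frag_of (a, b) \<in> carrier (free_Abelian_group (carrier A \<times> carrier B))"
    using assms by simp
  then show ?thesis unfolding pure_tensor_def tensor_def carrier_FactGroup by blast
qed

lemma pure_tensor_mult:
  assumes "monoid A" "monoid B"
  shows "\<lbrakk>a \<in> carrier A; a' \<in> carrier A; b \<in> carrier B\<rbrakk>
        \<Longrightarrow> pure_tensor A B (a \<otimes>\<^bsub>A\<^esub> a') b = pure_tensor A B a b \<otimes>\<^bsub>tensor A B\<^esub> pure_tensor A B a' b"
    and "\<lbrakk>a \<in> carrier A; b \<in> carrier B; b' \<in> carrier B\<rbrakk>
        \<Longrightarrow> pure_tensor A B a (b \<otimes>\<^bsub>B\<^esub> b') = pure_tensor A B a b \<otimes>\<^bsub>tensor A B\<^esub> pure_tensor A B a b'"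
proof -
  let ?F = "free_Abelian_group (carrier A \<times> carrier B)"
  note sum = normal.rcos_sum[OF tensor_kernel_normal[OF assms]]
  {
    assume a: "a \<in> carrier A" "a' \<in> carrier A" "b \<in> carrier B"
    then have "frag_of (a \<otimes>\<^bsub>A\<^esub> a', b) - (frag_of (a, b) + frag_of (a', b)) \<in> tensor_kernel A B"
      unfolding tensor_kernel_def tensor_relators_def by (blast intro: generate.incl)
    then show "pure_tensor A B (a \<otimes>\<^bsub>A\<^esub> a') b
        = pure_tensor A B a b \<otimes>\<^bsub>tensor A B\<^esub> pure_tensor A B a' b"
      using a sum[of "frag_of (a, b)" "frag_of (a', b)"]
      by (simp add: pure_tensor_def tensor_def flip: tensor_coset_eq[OF assms])
  }
  {
    assume a: "a \<in> carrier A" "b \<in> carrier B" "b' \<in> carrier B"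
    then have "frag_of (a, b \<otimes>\<^bsub>B\<^esub> b') - (frag_of (a, b) + frag_of (a, b')) \<in> tensor_kernel A B"
      unfolding tensor_kernel_def tensor_relators_def by (blast intro: generate.incl)
    then show "pure_tensor A B a (b \<otimes>\<^bsub>B\<^esub> b')
        = pure_tensor A B a b \<otimes>\<^bsub>tensor A B\<^esub> pure_tensor A B a b'"
      using a sum[of "frag_of (a, b)" "frag_of (a, b')"]
      by (simp add: pure_tensor_def tensor_def flip: tensor_coset_eq[OF assms])
  }
qed

lemma tensor_universal:
  assumes AB: "monoid A" "monoid B" and C: "comm_group C"
    and f: "\<And>a b. a \<in> carrier A \<Longrightarrow> b \<in> carrier B \<Longrightarrow> f a b \<in> carrier C"
    and f1: "\<And>a a' b. \<lbrakk>a \<in> carrier A; a' \<in> carrier A; b \<in> carrier B\<rbrakk>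
        \<Longrightarrow> f (a \<otimes>\<^bsub>A\<^esub> a') b = f a b \<otimes>\<^bsub>C\<^esub> f a' b"
    and f2: "\<And>a b b'. \<lbrakk>a \<in> carrier A; b \<in> carrier B; b' \<in> carrier B\<rbrakk>
        \<Longrightarrow> f a (b \<otimes>\<^bsub>B\<^esub> b') = f a b \<otimes>\<^bsub>C\<^esub> f a b'"
  shows "\<exists>g \<in> hom (tensor A B) C.
     \<forall>a \<in> carrier A. \<forall>b \<in> carrier B. g (pure_tensor A B a b) = f a b"
proof -
  let ?F = "free_Abelian_group (carrier A \<times> carrier B)"
  let ?N = "tensor_kernel A B"
  interpret C: comm_group C by fact
  interpret A: monoid A by (rule AB)
  interpret B: monoid B by (rule AB)
  have "case_prod f ` (carrier A \<times> carrier B) \<subseteq> carrier C" using f by auto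
  then obtain h where h: "h \<in> hom ?F C"
    and hf: "\<And>p. p \<in> carrier A \<times> carrier B \<Longrightarrow> h (frag_of p) = case_prod f p"
    using C.free_Abelian_group_universal by metis
  interpret h: group_hom ?F C h
    using h by (simp add: group_hom_def group_hom_axioms_def)
  have hdiff: "h (x - y) = h x \<otimes>\<^bsub>C\<^esub> inv\<^bsub>C\<^esub> h y" if "x \<in> carrier ?F" "y \<in> carrier ?F" for x y
  proof -
    have "x - y = x \<otimes>\<^bsub>?F\<^esub> inv\<^bsub>?F\<^esub> y" using that by simp
    then show ?thesis using that h.hom_mult h.hom_inv h.G.inv_closed by presburger
  qed
  have hadd: "h (x + y) = h x \<otimes>\<^bsub>C\<^esub> h y" if "x \<in> carrier ?F" "y \<in> carrier ?F" for x y
    using h.hom_mult[OF that] by simp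
  have rel: "h (frag_of p - (frag_of q + frag_of q')) = \<one>\<^bsub>C\<^esub>"
    if "p \<in> carrier A \<times> carrier B" "q \<in> carrier A \<times> carrier B" "q' \<in> carrier A \<times> carrier B"
      "case_prod f p = case_prod f q \<otimes>\<^bsub>C\<^esub> case_prod f q'" for p q q'
  proof -
    have c: "frag_of p \<in> carrier ?F" "frag_of q \<in> carrier ?F" "frag_of q' \<in> carrier ?F"
      using that by simp_all
    have "h (frag_of p - (frag_of q + frag_of q'))
        = case_prod f p \<otimes>\<^bsub>C\<^esub> inv\<^bsub>C\<^esub> (case_prod f q \<otimes>\<^bsub>C\<^esub> case_prod f q')"
      using hdiff[OF c(1) frag_add_closed[OF c(2,3)]] hadd[OF c(2,3)] hf that(1-3) by simp
    moreover have "case_prod f p \<in> carrier C" using that(1) f by auto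
    ultimately show ?thesis using that(4) by simp
  qed
  have "tensor_relators A B \<subseteq> kernel ?F C h"
  proof
    fix r assume r: "r \<in> tensor_relators A B"
    then have "h r = \<one>\<^bsub>C\<^esub>"
      unfolding tensor_relators_def using f1 f2 by (auto intro!: rel)
    then show "r \<in> kernel ?F C h"
      using r tensor_relators_subset[OF AB] unfolding kernel_def by blast
  qed
  then have N: "?N \<subseteq> kernel ?F C h"
    unfolding tensor_kernel_def
    using h.generate_subgroup_incl h.subgroup_kernel by blast
  have inj: "h x = h y" if "x \<in> carrier ?F" "y \<in> carrier ?F" "?N #>\<^bsub>?F\<^esub> x = ?N #>\<^bsub>?F\<^esub> y" for x y
  proof -
    have "h (x - y) = \<one>\<^bsub>C\<^esub>"
      using that(3) N unfolding tensor_coset_eq[OF AB] kernel_def by blast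
    then have "h x \<otimes>\<^bsub>C\<^esub> inv\<^bsub>C\<^esub> h y = \<one>\<^bsub>C\<^esub>" using hdiff[OF that(1,2)] by simp
    then show ?thesis using that h.hom_closed
      by (metis C.inv_equality C.inv_inv C.inv_closed)
  qed
  obtain g where g: "g \<in> hom (tensor A B) C" "\<And>x. x \<in> carrier ?F \<Longrightarrow> g (?N #>\<^bsub>?F\<^esub> x) = h x"
    unfolding tensor_def
    using FactGroup_universal[OF h tensor_kernel_normal[OF AB] inj] by metis
  have "g (pure_tensor A B a b) = f a b" if "a \<in> carrier A" "b \<in> carrier B" for a b
    using g(2)[of "frag_of (a, b)"] hf[of "(a, b)"] that by (simp add: pure_tensor_def)
  then show ?thesis using g(1) by blast
qed

lemma tensor_hom_unique:
  assumes AB: "monoid A" "monoid B" and C: "group C"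
    and g: "g \<in> hom (tensor A B) C" and g': "g' \<in> hom (tensor A B) C"
    and eq: "\<And>a b. a \<in> carrier A \<Longrightarrow> b \<in> carrier B
        \<Longrightarrow> g (pure_tensor A B a b) = g' (pure_tensor A B a b)"
    and U: "U \<in> carrier (tensor A B)"
  shows "g U = g' U"
proof -
  let ?F = "free_Abelian_group (carrier A \<times> carrier B)"
  let ?cl = "\<lambda>x. tensor_kernel A B #>\<^bsub>?F\<^esub> x"
  have cl: "?cl \<in> hom ?F (tensor A B)"
    unfolding tensor_def by (rule normal.r_coset_hom_Mod[OF tensor_kernel_normal[OF AB]])
  have hom: "group_hom ?F C (k \<circ> ?cl)" if "k \<in> hom (tensor A B) C" for k
    by (intro group_hom.intro group_hom_axioms.intro hom_compose[OF cl] C that) simp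
  obtain x where x: "Poly_Mapping.keys x \<subseteq> carrier A \<times> carrier B" "U = ?cl x"
    using U by (auto simp: tensor_def carrier_FactGroup)
  interpret C: group C by fact
  interpret g: group_hom ?F C "g \<circ> ?cl" using hom[OF g] .
  interpret g': group_hom ?F C "g' \<circ> ?cl" using hom[OF g'] .
  have "(g \<circ> ?cl) x = (g' \<circ> ?cl) x"
    using x(1)
  proof (induction x rule: frag_induct)
    case zero
    show ?case using g.hom_one g'.hom_one by simp
  next
    case (diff a b)
    have c: "a \<in> carrier ?F" "b \<in> carrier ?F" using diff by auto
    have "a - b = a \<otimes>\<^bsub>?F\<^esub> inv\<^bsub>?F\<^esub> b" using diff by simp
    then show ?case
      using diff c g.hom_mult g'.hom_mult g.hom_inv g'.hom_inv g.G.inv_closed by metis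
  next
    case (gen p)
    then show ?case using eq by (cases p) (auto simp: pure_tensor_def)
  qed
  then show ?thesis using x by simp
qed


section \<open>Properties of \<open>gamma\<close> and well-definedness of \<open>theta\<close>\<close>

lemma comm_group_quasi_lie_part: "monoid H \<Longrightarrow> comm_group (quasi_lie_part H n)"
  unfolding quasi_lie_part_def free_quasi_lie_def
  by (rule group.abelian_subgroup_generated)
    (use comm_group_nonassoc_quot[OF quasi_lie_relators_subset] in \<open>auto simp: comm_group_def\<close>)

lemma comm_group_lie_part: "monoid H \<Longrightarrow> comm_group (lie_part H n)"
  unfolding lie_part_def free_lie_def
  by (rule group.abelian_subgroup_generated)
    (use comm_group_nonassoc_quot[OF lie_relators_subset] in \<open>auto simp: comm_group_def\<close>)

lemma carrier_quasi_lie_part: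
  "monoid H \<Longrightarrow> carrier (quasi_lie_part H n)
     = (\<lambda>x. nonassoc_ideal H (quasi_lie_relators H) #>\<^bsub>nonassoc H\<^esub> x)
         ` {x. Poly_Mapping.keys x \<subseteq> {w \<in> lie_words H. weight w = n}}"
  unfolding quasi_lie_part_def free_quasi_lie_def
  by (rule nonassoc_quot_part[OF quasi_lie_relators_subset])

lemma carrier_lie_part:
  "monoid H \<Longrightarrow> carrier (lie_part H n)
     = (\<lambda>x. nonassoc_ideal H (lie_relators H) #>\<^bsub>nonassoc H\<^esub> x)
         ` {x. Poly_Mapping.keys x \<subseteq> {w \<in> lie_words H. weight w = n}}"
  unfolding lie_part_def free_lie_def
  by (rule nonassoc_quot_part[OF lie_relators_subset])

lemma part_simps:
  "monoid.mult (quasi_lie_part H n) = monoid.mult (free_quasi_lie H)"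
  "\<one>\<^bsub>quasi_lie_part H n\<^esub> = \<one>\<^bsub>free_quasi_lie H\<^esub>"
  "monoid.mult (lie_part H n) = monoid.mult (free_lie H)"
  "\<one>\<^bsub>lie_part H n\<^esub> = \<one>\<^bsub>free_lie H\<^esub>"
  by (simp_all add: quasi_lie_part_def lie_part_def subgroup_generated_def)

lemma quasi_lie_to_lie_coset:
  assumes "monoid H" "x \<in> carrier (nonassoc H)"
  shows "quasi_lie_to_lie H (nonassoc_ideal H (quasi_lie_relators H) #>\<^bsub>nonassoc H\<^esub> x)
       = nonassoc_ideal H (lie_relators H) #>\<^bsub>nonassoc H\<^esub> x"
proof -
  let ?I = "nonassoc_ideal H (quasi_lie_relators H)"
  let ?J = "nonassoc_ideal H (lie_relators H)"
  have "?I #>\<^bsub>nonassoc H\<^esub> x \<in> carrier (free_quasi_lie H)"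
    using assms(2)
    unfolding free_quasi_lie_def carrier_nonassoc_quot[OF quasi_lie_relators_subset[OF assms(1)]]
    by blast
  then have "quasi_lie_to_lie H (?I #>\<^bsub>nonassoc H\<^esub> x) = (\<Union>i\<in>?I. ?J #>\<^bsub>nonassoc H\<^esub> (i + x))"
    by (simp add: quasi_lie_to_lie_def frag_coset)
  moreover have "?J #>\<^bsub>nonassoc H\<^esub> (i + x) = ?J #>\<^bsub>nonassoc H\<^esub> x" if "i \<in> ?I" for i
    unfolding nonassoc_coset_eq
    using that nonassoc_ideal_mono[of "quasi_lie_relators H" "lie_relators H" H]
    by (auto simp: lie_relators_def)
  ultimately show ?thesis using nonassoc_ideal.zero by fast
qed

theorem quasi_lie_to_lie_hom:
  assumes "monoid H"
  shows "quasi_lie_to_lie H \<in> lie_hom (free_quasi_lie H) (free_lie H)"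
    and "h \<in> carrier H \<Longrightarrow> quasi_lie_to_lie H (quasi_lie_gen H h) = lie_gen H h"
proof -
  note R = quasi_lie_relators_subset[OF assms] lie_relators_subset[OF assms]
  note simps = carrier_nonassoc_quot[OF R(1)] carrier_nonassoc_quot[OF R(2)]
    mult_nonassoc_quot[OF R(1)] mult_nonassoc_quot[OF R(2)]
    bracket_nonassoc_quot[OF R(1)] bracket_nonassoc_quot[OF R(2)]
    quasi_lie_to_lie_coset[OF assms] br_closed frag_add_closed[where S = "lie_words H"]
  show "quasi_lie_to_lie H \<in> lie_hom (free_quasi_lie H) (free_lie H)"
    unfolding lie_hom_def hom_def free_quasi_lie_def free_lie_def
    by (auto simp: simps simp del: carrier_free_Abelian_group_iff)
  show "quasi_lie_to_lie H (quasi_lie_gen H h) = lie_gen H h" if "h \<in> carrier H"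
    using that by (simp add: quasi_lie_gen_def lie_gen_def simps)
qed

lemma gamma_coset:
  assumes "monoid H" "Poly_Mapping.keys x \<subseteq> {w \<in> lie_words H. weight w = n}"
  shows "gamma H n (nonassoc_ideal H (quasi_lie_relators H) #>\<^bsub>nonassoc H\<^esub> x)
       = nonassoc_ideal H (lie_relators H) #>\<^bsub>nonassoc H\<^esub> x"
proof -
  have "x \<in> carrier (nonassoc H)" using assms(2) by auto
  moreover have "nonassoc_ideal H (quasi_lie_relators H) #>\<^bsub>nonassoc H\<^esub> x
      \<in> carrier (quasi_lie_part H n)"
    unfolding carrier_quasi_lie_part[OF assms(1)] using assms(2) by blast
  ultimately show ?thesis
    by (simp add: gamma_def quasi_lie_to_lie_coset[OF assms(1)])
qed

theorem gamma_epi: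
  assumes "monoid H"
  shows "gamma H n \<in> epi (quasi_lie_part H n) (lie_part H n)"
proof -
  interpret Q: quasi_lie_algebra "free_quasi_lie H"
    by (rule quasi_lie_algebra_free_quasi_lie[OF assms])
  interpret P: comm_group "quasi_lie_part H n" by (rule comm_group_quasi_lie_part[OF assms])
  have im: "gamma H n ` carrier (quasi_lie_part H n) = carrier (lie_part H n)"
    unfolding carrier_quasi_lie_part[OF assms] carrier_lie_part[OF assms] image_image
    by (rule image_cong) (use gamma_coset[OF assms] in auto)
  have "gamma H n \<in> hom (quasi_lie_part H n) (lie_part H n)"
  proof (rule homI)
    fix U V assume UV: "U \<in> carrier (quasi_lie_part H n)" "V \<in> carrier (quasi_lie_part H n)"
    show "gamma H n U \<in> carrier (lie_part H n)" using im UV by blast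
    have sub: "carrier (quasi_lie_part H n) \<subseteq> carrier (free_quasi_lie H)"
      unfolding quasi_lie_part_def by (rule Q.carrier_subgroup_generated_subset)
    have "U \<otimes>\<^bsub>free_quasi_lie H\<^esub> V \<in> carrier (quasi_lie_part H n)"
      using P.m_closed[OF UV] by (simp add: part_simps)
    then show "gamma H n (U \<otimes>\<^bsub>quasi_lie_part H n\<^esub> V)
        = gamma H n U \<otimes>\<^bsub>lie_part H n\<^esub> gamma H n V"
      using UV sub quasi_lie_to_lie_hom(1)[OF assms]
      by (auto simp: gamma_def part_simps lie_hom_def hom_def subset_iff)
  qed
  then show ?thesis using im by (simp add: epi_def)
qed

lemma lie_relators_ideal_central:
  assumes "monoid H" "z \<in> nonassoc_ideal H (lie_relators H)" "y \<in> carrier (nonassoc H)"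
  shows "br z y \<in> nonassoc_ideal H (quasi_lie_relators H)"
proof -
  let ?I = "nonassoc_ideal H (quasi_lie_relators H)"
  note R = quasi_lie_relators_subset[OF assms(1)]
  have anti: "br x y + br y x \<in> ?I"
    if "x \<in> carrier (nonassoc H)" "y \<in> carrier (nonassoc H)" for x y
    using that unfolding quasi_lie_relators_def by (blast intro: nonassoc_ideal.base)
  have jac: "br (br x y) z + br (br y z) x + br (br z x) y \<in> ?I"
    if "x \<in> carrier (nonassoc H)" "y \<in> carrier (nonassoc H)" "z \<in> carrier (nonassoc H)" for x y z
    using that unfolding quasi_lie_relators_def by (blast intro: nonassoc_ideal.base)
  have sub: "\<And>x. x \<in> nonassoc_ideal H (lie_relators H) \<Longrightarrow> x \<in> carrier (nonassoc H)"
    using nonassoc_ideal_subset[OF lie_relators_subset[OF assms(1)]] by blast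
  show ?thesis
    using assms(2,3)
  proof (induction arbitrary: y)
    case (base r)
    then consider "r \<in> quasi_lie_relators H" | x where "x \<in> carrier (nonassoc H)" "r = br x x"
      unfolding lie_relators_def by blast
    then show ?case
    proof cases
      case 1
      then show ?thesis using base by (blast intro: nonassoc_ideal.intros)
    next
      case 2
      note c = 2(1) \<open>y \<in> carrier (nonassoc H)\<close>
      have "br (br x x) y + br (br x y) x + br (br y x) x \<in> ?I" using jac c by blast
      moreover have "br (br x y + br y x) x \<in> ?I"
        using anti c by (blast intro: nonassoc_ideal.right)
      ultimately have "(br (br x x) y + br (br x y) x + br (br y x) x)
          - br (br x y + br y x) x \<in> ?I"
        by (rule nonassoc_ideal.diff)
      then show ?thesis using 2 by (simp add: br_add_left)
    qed
  next
    case zero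
    show ?case by (simp add: nonassoc_ideal.zero)
  next
    case (diff x x')
    then show ?case by (simp add: br_diff_left nonassoc_ideal.diff)
  next
    case (left x t)
    have "br x t \<in> ?I" using left(3)[OF left(2)] .
    from nonassoc_ideal.diff[OF anti[OF left(2) sub[OF left(1)]] this]
    have "br t x \<in> ?I" by simp
    then show ?case using left(4) by (rule nonassoc_ideal.right)
  next
    case (right x t)
    show ?case by (rule nonassoc_ideal.right[OF right(3)[OF right(2)] right(4)])
  qed
qed

text \<open>The next lemma contains the well-definedness of \<open>theta H k\<close>.\<close>

lemma bracket_square:
  assumes "monoid H"
  shows "\<lbrakk>a \<in> carrier (free_quasi_lie H); b \<in> carrier (free_quasi_lie H)\<rbrakk>
      \<Longrightarrow> bracket (free_quasi_lie H) (a \<otimes>\<^bsub>free_quasi_lie H\<^esub> b) (a \<otimes>\<^bsub>free_quasi_lie H\<^esub> b)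
        = bracket (free_quasi_lie H) a a \<otimes>\<^bsub>free_quasi_lie H\<^esub> bracket (free_quasi_lie H) b b"
    and "\<lbrakk>a \<in> carrier (quasi_lie_part H k); b \<in> carrier (quasi_lie_part H k);
        gamma H k a = gamma H k b\<rbrakk>
      \<Longrightarrow> bracket (free_quasi_lie H) a a = bracket (free_quasi_lie H) b b"
    and "a \<in> carrier (quasi_lie_part H k)
      \<Longrightarrow> bracket (free_quasi_lie H) a a \<in> carrier (quasi_lie_part H (2 * k))"
proof -
  interpret Q: quasi_lie_algebra "free_quasi_lie H"
    by (rule quasi_lie_algebra_free_quasi_lie[OF assms])
  note R = quasi_lie_relators_subset[OF assms]
  let ?b = "bracket (free_quasi_lie H)"
  let ?m = "monoid.mult (free_quasi_lie H)"
  let ?I = "nonassoc_ideal H (quasi_lie_relators H)"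
  {
    assume ab: "a \<in> carrier (free_quasi_lie H)" "b \<in> carrier (free_quasi_lie H)"
    note c = ab Q.bracket_closed[OF ab(1,1)] Q.bracket_closed[OF ab(1,2)]
      Q.bracket_closed[OF ab(2,1)] Q.bracket_closed[OF ab(2,2)]
    have "?b (?m a b) (?m a b) = ?m (?m (?b a a) (?b a b)) (?m (?b b a) (?b b b))"
      using c by (simp add: Q.bracket_mult_left Q.bracket_mult_right Q.m_ac)
    also have "\<dots> = ?m (?b a a) (?m (?m (?b a b) (?b b a)) (?b b b))"
      using c by (simp add: Q.m_assoc)
    finally show "?b (?m a b) (?m a b) = ?m (?b a a) (?b b b)"
      using c by (simp add: Q.bracket_antisym)
  }
  {
    assume ab: "a \<in> carrier (quasi_lie_part H k)" "b \<in> carrier (quasi_lie_part H k)"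
      "gamma H k a = gamma H k b"
    then obtain x y where x: "Poly_Mapping.keys x \<subseteq> {w \<in> lie_words H. weight w = k}"
        "a = ?I #>\<^bsub>nonassoc H\<^esub> x"
      and y: "Poly_Mapping.keys y \<subseteq> {w \<in> lie_words H. weight w = k}" "b = ?I #>\<^bsub>nonassoc H\<^esub> y"
      unfolding carrier_quasi_lie_part[OF assms] by blast
    have c: "x \<in> carrier (nonassoc H)" "y \<in> carrier (nonassoc H)" using x y by auto
    have d: "x - y \<in> nonassoc_ideal H (lie_relators H)"
      using ab(3) x y by (simp add: gamma_coset[OF assms] nonassoc_coset_eq)
    have dc: "x - y \<in> carrier (nonassoc H)" by (rule frag_diff_closed[OF c])
    have 1: "br (x - y) z \<in> ?I" if "z \<in> carrier (nonassoc H)" for z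
      using lie_relators_ideal_central[OF assms d that] .
    have "br (x - y) y + br y (x - y) \<in> ?I"
      unfolding quasi_lie_relators_def using c dc by (blast intro: nonassoc_ideal.base)
    then have "br y (x - y) \<in> ?I"
      using nonassoc_ideal.diff[OF _ 1[OF c(2)]] by fastforce
    then have "br (x - y) x + br y (x - y) \<in> ?I"
      using nonassoc_ideal_add[OF 1[OF c(1)]] by blast
    then have "br x x - br y y \<in> ?I"
      by (simp add: br_diff_left br_diff_right)
    then have "?I #>\<^bsub>nonassoc H\<^esub> br x x = ?I #>\<^bsub>nonassoc H\<^esub> br y y"
      unfolding nonassoc_coset_eq .
    then show "?b a a = ?b b b"
      using x(2) y(2) c by (simp add: free_quasi_lie_def bracket_nonassoc_quot[OF R])
  }
  {
    assume "a \<in> carrier (quasi_lie_part H k)"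
    then obtain x where x: "Poly_Mapping.keys x \<subseteq> {w \<in> lie_words H. weight w = k}"
        "a = ?I #>\<^bsub>nonassoc H\<^esub> x"
      unfolding carrier_quasi_lie_part[OF assms] by blast
    have "Poly_Mapping.keys (br x x) \<subseteq> {w \<in> lie_words H. weight w = 2 * k}"
      by (rule br_keys[OF x(1) x(1)]) auto
    moreover have "x \<in> carrier (nonassoc H)" using x by auto
    then have "?b a a = ?I #>\<^bsub>nonassoc H\<^esub> br x x"
      using x(2) by (simp add: free_quasi_lie_def bracket_nonassoc_quot[OF R])
    ultimately show "?b a a \<in> carrier (quasi_lie_part H (2 * k))"
      unfolding carrier_quasi_lie_part[OF assms] by blast
  }
qed

theorem theta_ex1:
  assumes "monoid H"
  shows "\<exists>!f. f \<in> extensional (carrier (tensor (lie_part H k) (integer_mod_group 2))) \<and>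
     f \<in> hom (tensor (lie_part H k) (integer_mod_group 2)) (quasi_lie_part H (2 * k)) \<and>
     (\<forall>a \<in> carrier (quasi_lie_part H k).
        f (pure_tensor (lie_part H k) (integer_mod_group 2) (gamma H k a) 1)
          = bracket (free_quasi_lie H) a a)"
proof -
  let ?P = "lie_part H k" and ?Z = "integer_mod_group 2" and ?C = "quasi_lie_part H (2 * k)"
  let ?T = "tensor ?P ?Z"
  let ?b = "bracket (free_quasi_lie H)"
  interpret Q: quasi_lie_algebra "free_quasi_lie H"
    by (rule quasi_lie_algebra_free_quasi_lie[OF assms])
  interpret QP: comm_group "quasi_lie_part H k" by (rule comm_group_quasi_lie_part[OF assms])
  interpret C: comm_group ?C by (rule comm_group_quasi_lie_part[OF assms])
  interpret P: comm_group ?P by (rule comm_group_lie_part[OF assms])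
  interpret Z: comm_group ?Z by simp
  interpret T: comm_group ?T
    by (rule comm_group_tensor) (simp_all add: P.monoid_axioms Z.monoid_axioms)
  note M = P.monoid_axioms Z.monoid_axioms
  have sub: "a \<in> carrier (quasi_lie_part H k) \<Longrightarrow> a \<in> carrier (free_quasi_lie H)" for a
    using Q.carrier_subgroup_generated_subset unfolding quasi_lie_part_def by blast
  have g: "gamma H k \<in> hom (quasi_lie_part H k) ?P"
    and im: "gamma H k ` carrier (quasi_lie_part H k) = carrier ?P"
    using gamma_epi[OF assms, of k] by (auto simp: epi_def)
  have Zc: "carrier ?Z = {0, 1}" by (auto simp: carrier_integer_mod_group)
  define lift where "lift \<alpha> = (SOME a. a \<in> carrier (quasi_lie_part H k) \<and> gamma H k a = \<alpha>)" for \<alpha>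
  have lift: "lift \<alpha> \<in> carrier (quasi_lie_part H k)" "gamma H k (lift \<alpha>) = \<alpha>"
    if "\<alpha> \<in> carrier ?P" for \<alpha>
  proof -
    have "\<exists>a. a \<in> carrier (quasi_lie_part H k) \<and> gamma H k a = \<alpha>"
      using that im by (metis imageE)
    from someI_ex[OF this] show "lift \<alpha> \<in> carrier (quasi_lie_part H k)" "gamma H k (lift \<alpha>) = \<alpha>"
      unfolding lift_def by auto
  qed
  define sq where "sq \<alpha> = ?b (lift \<alpha>) (lift \<alpha>)" for \<alpha>
  have sq: "sq (gamma H k a) = ?b a a" if "a \<in> carrier (quasi_lie_part H k)" for a
  proof -
    have "gamma H k a \<in> carrier ?P" using im that by blast
    from bracket_square(2)[OF assms lift(1)[OF this] that lift(2)[OF this]]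
    show ?thesis unfolding sq_def .
  qed
  have sqc: "sq \<alpha> \<in> carrier ?C" if "\<alpha> \<in> carrier ?P" for \<alpha>
    unfolding sq_def using bracket_square(3)[OF assms] lift(1)[OF that] by blast
  have sqm: "sq (\<alpha> \<otimes>\<^bsub>?P\<^esub> \<beta>) = sq \<alpha> \<otimes>\<^bsub>?C\<^esub> sq \<beta>" if "\<alpha> \<in> carrier ?P" "\<beta> \<in> carrier ?P" for \<alpha> \<beta>
  proof -
    note l = lift[OF that(1)] lift[OF that(2)]
    have "sq (\<alpha> \<otimes>\<^bsub>?P\<^esub> \<beta>) = sq (gamma H k (lift \<alpha> \<otimes>\<^bsub>quasi_lie_part H k\<^esub> lift \<beta>))"
      using hom_mult[OF g l(1,3)] l by simp
    also have "\<dots> = sq \<alpha> \<otimes>\<^bsub>?C\<^esub> sq \<beta>"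
      using sq[OF QP.m_closed[OF l(1,3)]] bracket_square(1)[OF assms sub[OF l(1)] sub[OF l(3)]]
      by (simp add: sq_def part_simps)
    finally show ?thesis .
  qed
  have sq2: "sq \<alpha> \<otimes>\<^bsub>?C\<^esub> sq \<alpha> = \<one>\<^bsub>?C\<^esub>" if "\<alpha> \<in> carrier ?P" for \<alpha>
    using Q.bracket_antisym[OF sub sub, OF lift(1) lift(1), OF that that]
    by (simp add: sq_def part_simps)
  have "\<exists>f \<in> hom ?T ?C. \<forall>\<alpha> \<in> carrier ?P. \<forall>m \<in> carrier ?Z.
      f (pure_tensor ?P ?Z \<alpha> m) = (if m = 0 then \<one>\<^bsub>?C\<^esub> else sq \<alpha>)"
  proof (rule tensor_universal[OF M C.comm_group_axioms])
    fix \<alpha> m assume "\<alpha> \<in> carrier ?P" "m \<in> carrier ?Z"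
    then show "(if m = 0 then \<one>\<^bsub>?C\<^esub> else sq \<alpha>) \<in> carrier ?C"
      using sqc C.one_closed by presburger
  next
    fix \<alpha> \<beta> m assume ab: "\<alpha> \<in> carrier ?P" "\<beta> \<in> carrier ?P" "m \<in> carrier ?Z"
    show "(if m = 0 then \<one>\<^bsub>?C\<^esub> else sq (\<alpha> \<otimes>\<^bsub>?P\<^esub> \<beta>))
        = (if m = 0 then \<one>\<^bsub>?C\<^esub> else sq \<alpha>) \<otimes>\<^bsub>?C\<^esub> (if m = 0 then \<one>\<^bsub>?C\<^esub> else sq \<beta>)"
      using sqm[OF ab(1,2)] C.l_one[OF C.one_closed] by presburger
  next
    fix \<alpha> m m' assume a: "\<alpha> \<in> carrier ?P" "m \<in> carrier ?Z" "m' \<in> carrier ?Z"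
    then have "m = 0 \<or> m = 1" "m' = 0 \<or> m' = 1" unfolding Zc by blast+
    then show "(if m \<otimes>\<^bsub>?Z\<^esub> m' = 0 then \<one>\<^bsub>?C\<^esub> else sq \<alpha>)
        = (if m = 0 then \<one>\<^bsub>?C\<^esub> else sq \<alpha>) \<otimes>\<^bsub>?C\<^esub> (if m' = 0 then \<one>\<^bsub>?C\<^esub> else sq \<alpha>)"
      using sq2[OF a(1)] sqc[OF a(1)] by (elim disjE) simp_all
  qed
  then obtain f where f: "f \<in> hom ?T ?C"
      "\<And>\<alpha> m. \<alpha> \<in> carrier ?P \<Longrightarrow> m \<in> carrier ?Z
         \<Longrightarrow> f (pure_tensor ?P ?Z \<alpha> m) = (if m = 0 then \<one>\<^bsub>?C\<^esub> else sq \<alpha>)"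
    by blast
  let ?f = "restrict f (carrier ?T)"
  have "?f \<in> hom ?T ?C" using f(1) by (auto simp: hom_def)
  moreover have "?f (pure_tensor ?P ?Z (gamma H k a) 1) = ?b a a"
    if "a \<in> carrier (quasi_lie_part H k)" for a
  proof -
    have c: "gamma H k a \<in> carrier ?P" using im that by blast
    then show ?thesis
      using f(2)[OF c, of 1] sq[OF that] pure_tensor_closed[OF c, of 1 ?Z] by simp
  qed
  moreover have "l = l'"
    if l: "l \<in> extensional (carrier ?T)" "l' \<in> extensional (carrier ?T)"
      "l \<in> hom ?T ?C" "l' \<in> hom ?T ?C"
      "\<forall>a \<in> carrier (quasi_lie_part H k). l (pure_tensor ?P ?Z (gamma H k a) 1) = ?b a a"
      "\<forall>a \<in> carrier (quasi_lie_part H k). l' (pure_tensor ?P ?Z (gamma H k a) 1) = ?b a a"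
    for l l'
  proof (rule extensionalityI[OF l(1,2)])
    fix U assume U: "U \<in> carrier ?T"
    show "l U = l' U"
    proof (rule tensor_hom_unique[OF M C.is_group l(3,4) _ U])
      fix \<alpha> m assume am: "\<alpha> \<in> carrier ?P" "m \<in> carrier ?Z"
      show "l (pure_tensor ?P ?Z \<alpha> m) = l' (pure_tensor ?P ?Z \<alpha> m)"
      proof (cases "m = 0")
        case True
        have c: "pure_tensor ?P ?Z \<alpha> 0 \<in> carrier ?T"
          by (rule pure_tensor_closed[OF am(1)]) simp
        have "pure_tensor ?P ?Z \<alpha> 0 \<otimes>\<^bsub>?T\<^esub> pure_tensor ?P ?Z \<alpha> 0 = pure_tensor ?P ?Z \<alpha> 0"
          using pure_tensor_mult(2)[OF M am(1), of 0 0] by simp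
        then have "pure_tensor ?P ?Z \<alpha> 0 = \<one>\<^bsub>?T\<^esub>"
          using c by (metis T.l_cancel_one')
        then show ?thesis
          using True hom_one[OF l(3) T.is_group C.is_group] hom_one[OF l(4) T.is_group C.is_group]
          by simp
      next
        case False
        then have "m = 1" using am Zc by auto
        then show ?thesis using l(5,6) lift[OF am(1)] by metis
      qed
    qed
  qed
  ultimately show ?thesis
    by (intro ex1I[of _ ?f]) auto
qed

theorem theta_props:
  assumes "monoid H"
  shows "theta H k \<in> hom (tensor (lie_part H k) (integer_mod_group 2)) (quasi_lie_part H (2 * k))"
    and "a \<in> carrier (quasi_lie_part H k)
      \<Longrightarrow> theta H k (pure_tensor (lie_part H k) (integer_mod_group 2) (gamma H k a) 1)
        = bracket (free_quasi_lie H) a a"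
  using theI'[OF theta_ex1[OF assms, of k]] by (simp_all add: theta_def)

end

theory Submission
  imports Defs
begin

text \<open>
  Write \<open>L'\<close> and \<open>L\<close> for the free quasi-Lie algebra and the free Lie algebra, \<open>I\<close> and \<open>J\<close> for
  their defining ideals in the free nonassociative ring.  Since squares \<open>[x, x]\<close> are central in
  \<open>L'\<close>, and additive in \<open>x\<close>, the ideal \<open>J\<close> is \<open>I\<close> plus the set of all squares
  (\<open>lie_ideal_degree_part\<close>, degree by degree).  This is exactness in the middle.
  
  The rest follows from one divisibility statement
  (\<open>square_eq_double_imp_gamma_double\<close>): if \<open>[a, a]\<close> is divisible by two in \<open>L'\<close>, then the image
  of \<open>a\<close> in \<open>L\<close> is divisible by two.  When \<open>[a, a] = 0\<close> it says that \<open>theta\<close> is injective.  In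
  general it says that the image of \<open>theta\<close>, which has exponent two, meets the doubles of \<open>L'\<close>
  only in zero; a subgroup that is maximal among those that contain all doubles and
  meet the image of \<open>theta\<close> only in zero is then a complement (\<open>ex_complement\<close>), and inverting
  \<open>gamma\<close> on this complement gives the splitting.
  
  Divisibility by two is a statement about the quotients by \<open>I\<close> and \<open>J\<close> together with all
  doubles, and so about free algebras on letters: if \<open>[p, p]\<close> vanishes in the free quasi-Lie ring
  modulo two, then \<open>p\<close> vanishes in the free Lie ring modulo two
  (\<open>square_quasi2_imp_lie2\<close>).  The proof is Lazard elimination.  For a letter \<open>x\<close>, the elements
  \<open>ad(x)\<^sup>i y\<close> with \<open>y \<noteq> x\<close> a letter generate a subalgebra that contains everything up to multiples
  of \<open>x\<close> and \<open>[x, x]\<close>.  Rewriting a word in the new letters \<open>y\<^sub>i\<close>, which stand for \<open>ad(x)\<^sup>i y\<close>,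
  shortens it as soon as it contains \<open>x\<close>.  The rewriting respects the quasi-Lie relations
  (\<open>elim_quasi2\<close>), and substituting \<open>ad(x)\<^sup>i y\<close> for \<open>y\<^sub>i\<close> undoes it modulo the Lie relations, up to a
  multiple of \<open>x\<close> (\<open>unelim_elim\<close>).  That multiple is even because \<open>[x, x] \<noteq> 0\<close> modulo two
  (\<open>square_quasi2_even\<close>).  Eliminating one by one the letters that occur in the longest words lowers
  the length until \<open>p\<close> is zero.
\<close>

section \<open>Homomorphisms and coefficients in the free nonassociative ring\<close>

lemma frag_biadditive_eqI:
  fixes f g :: "('a \<Rightarrow>\<^sub>0 int) \<Rightarrow> ('b \<Rightarrow>\<^sub>0 int) \<Rightarrow> 'c::ab_group_add"
  assumes "\<And>a b c. f (a - b) c = f a c - f b c" "\<And>a b c. f c (a - b) = f c a - f c b"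
    and "\<And>a b c. g (a - b) c = g a c - g b c" "\<And>a b c. g c (a - b) = g c a - g c b"
    and "\<And>u v. f (frag_of u) (frag_of v) = g (frag_of u) (frag_of v)"
  shows "f x y = g x y"
proof (rule frag_eqI[where f = "\<lambda>x. f x y" and g = "\<lambda>x. g x y" and S = UNIV])
  show "f (frag_of u) y = g (frag_of u) y" for u
    by (rule frag_eqI[where S = UNIV]) (use assms in auto)
qed (use assms in auto)

lemma frag_cmul_diff2: "frag_cmul c (a - b) = frag_cmul c a - frag_cmul c b"
  by (rule poly_mapping_eqI) (simp add: lookup_minus algebra_simps)

lemma frag_cmul_even:
  assumes "even c"
  shows "\<exists>y. frag_cmul c x = y + y"
proof -
  obtain d where "c = d + d" using assms by (metis evenE mult_2)
  then show ?thesis using frag_cmul_distrib by metis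
qed

lemma br_cmul_left: "br (frag_cmul c p) q = frag_cmul c (br p q)"
  by (simp add: br_def frag_extend_cmul)

lemma br_cmul_right: "br p (frag_cmul c q) = frag_cmul c (br p q)"
proof (rule frag_biadditive_eqI[where f = "\<lambda>p q. br p (frag_cmul c q)"])
  show "br (frag_of u) (frag_cmul c (frag_of v)) = frag_cmul c (br (frag_of u) (frag_of v))"
    for u v :: "'a lie_word"
    by (simp add: br_def frag_extend_cmul)
qed (simp_all add: br_diff_left br_diff_right frag_cmul_diff2)

lemma lookup_frag_of: "Poly_Mapping.lookup (frag_of u) v = (if u = v then 1 else 0)"
  by (simp add: lookup_single when_def)

text \<open>
  No word is a bracket in two ways, so the coefficients of a product are products of coefficients.
\<close>

lemma lookup_br_Br:
  "Poly_Mapping.lookup (br p q) (Br u v) = Poly_Mapping.lookup p u * Poly_Mapping.lookup q v"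
  by (rule frag_biadditive_eqI[where f = "\<lambda>p q. Poly_Mapping.lookup (br p q) (Br u v)"])
    (simp_all add: br_diff_left br_diff_right lookup_minus algebra_simps lookup_frag_of)

lemma lookup_br_Gen: "Poly_Mapping.lookup (br p q) (Gen y) = 0"
  by (rule frag_biadditive_eqI[where f = "\<lambda>p q. Poly_Mapping.lookup (br p q) (Gen y)"])
    (simp_all add: br_diff_left br_diff_right lookup_minus lookup_frag_of)

primrec word_subst :: "('x \<Rightarrow> ('y lie_word \<Rightarrow>\<^sub>0 int)) \<Rightarrow> 'x lie_word \<Rightarrow> ('y lie_word \<Rightarrow>\<^sub>0 int)" where
  "word_subst f (Gen y) = f y"
| "word_subst f (Br u v) = br (word_subst f u) (word_subst f v)"

definition substitute ::
  "('x \<Rightarrow> ('y lie_word \<Rightarrow>\<^sub>0 int)) \<Rightarrow> ('x lie_word \<Rightarrow>\<^sub>0 int) \<Rightarrow> ('y lie_word \<Rightarrow>\<^sub>0 int)" where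
  "substitute f = frag_extend (word_subst f)"

lemma substitute_simps [simp]:
  "substitute f 0 = 0" "substitute f (frag_of (Gen y)) = f y"
  "substitute f (p - q) = substitute f p - substitute f q"
  "substitute f (p + q) = substitute f p + substitute f q"
  by (simp_all add: substitute_def frag_extend_diff frag_extend_add)

lemma substitute_br [simp]: "substitute f (br p q) = br (substitute f p) (substitute f q)"
proof (rule frag_biadditive_eqI[where f = "\<lambda>p q. substitute f (br p q)"])
  show "substitute f (br (frag_of u) (frag_of v))
      = br (substitute f (frag_of u)) (substitute f (frag_of v))" for u v
    by (simp add: substitute_def)
qed (simp_all add: br_diff_left br_diff_right)


section \<open>The free quasi-Lie and Lie rings modulo two\<close>

text \<open>
  The defining ideals of the free quasi-Lie ring and of the free Lie ring over the field with two
  elements, on all letters of the type.  Closure under brackets on the right is a consequence of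
  antisymmetry.
\<close>

inductive_set quasi2 :: "('x lie_word \<Rightarrow>\<^sub>0 int) set" where
  double: "p + p \<in> quasi2"
| anti: "br p q + br q p \<in> quasi2"
| jac: "br (br p q) s + br (br q s) p + br (br s p) q \<in> quasi2"
| diff: "\<lbrakk>p \<in> quasi2; q \<in> quasi2\<rbrakk> \<Longrightarrow> p - q \<in> quasi2"
| left: "p \<in> quasi2 \<Longrightarrow> br q p \<in> quasi2"

inductive_set lie2 :: "('x lie_word \<Rightarrow>\<^sub>0 int) set" where
  double: "p + p \<in> lie2"
| self: "br p p \<in> lie2"
| jac: "br (br p q) s + br (br q s) p + br (br s p) q \<in> lie2"
| diff: "\<lbrakk>p \<in> lie2; q \<in> lie2\<rbrakk> \<Longrightarrow> p - q \<in> lie2"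
| left: "p \<in> lie2 \<Longrightarrow> br q p \<in> lie2"

lemma quasi2_zero: "0 \<in> quasi2"
  using quasi2.double[of 0] by simp

lemma quasi2_add: "p \<in> quasi2 \<Longrightarrow> q \<in> quasi2 \<Longrightarrow> p + q \<in> quasi2"
  using quasi2.diff[OF _ quasi2.diff[OF quasi2_zero]] by fastforce

lemma quasi2_cmul: "p \<in> quasi2 \<Longrightarrow> frag_cmul c p \<in> quasi2"
proof (induction c rule: int_induct[where k = 0])
  case base
  then show ?case by (simp add: quasi2_zero)
next
  case (step1 i)
  then show ?case using quasi2_add by (simp add: frag_cmul_distrib)
next
  case (step2 i)
  then show ?case using quasi2.diff by (simp add: frag_cmul_diff_distrib)
qed

lemma quasi2_right:
  assumes "p \<in> quasi2" shows "br p q \<in> quasi2"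
  using quasi2.diff[OF quasi2.anti[of p q] quasi2.left[OF assms, of q]] by simp

lemma lie2_zero: "0 \<in> lie2"
  using lie2.double[of 0] by simp

lemma lie2_add: "p \<in> lie2 \<Longrightarrow> q \<in> lie2 \<Longrightarrow> p + q \<in> lie2"
  using lie2.diff[OF _ lie2.diff[OF lie2_zero]] by fastforce

lemma lie2_anti: "br p q + br q p \<in> lie2"
proof -
  have "br (p + q) (p + q) - br p p - br q q \<in> lie2"
    by (intro lie2.diff lie2.self)
  then show ?thesis by (simp add: br_add_left br_add_right algebra_simps)
qed

lemma lie2_right:
  assumes "p \<in> lie2" shows "br p q \<in> lie2"
  using lie2.diff[OF lie2_anti[of p q] lie2.left[OF assms, of q]] by simp

lemma substitute_lie2:
  assumes "p \<in> lie2" shows "substitute f p \<in> lie2"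
  using assms by induction (auto intro: lie2.intros)

text \<open>
  Antisymmetry and the Jacobi identity involve only words of weight at least two, and antisymmetry
  contributes twice the product of linear coefficients to the coefficient of \<open>[x, x]\<close>.  So \<open>[x, x]\<close>
  is not zero in the free quasi-Lie ring modulo two, and the parity of its coefficient in \<open>[p, p]\<close>
  is that of the coefficient of \<open>x\<close> in \<open>p\<close>.
\<close>

lemma quasi2_even_linear:
  assumes "p \<in> quasi2" shows "even (Poly_Mapping.lookup p (Gen x))"
  using assms
  by induction (simp_all add: lookup_add lookup_minus lookup_br_Gen)

lemma quasi2_even_square:
  assumes "p \<in> quasi2" shows "even (Poly_Mapping.lookup p (Br (Gen x) (Gen x)))"
  using assms
  by induction (simp_all add: lookup_add lookup_minus lookup_br_Br lookup_br_Gen quasi2_even_linear)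

lemma square_quasi2_even:
  assumes "br p p \<in> quasi2" shows "even (Poly_Mapping.lookup p (Gen x))"
  using quasi2_even_square[OF assms, of x] by (simp add: lookup_br_Br)


section \<open>Elimination of a generator\<close>

text \<open>
  The letter coded by \<open>prod_encode (y, i)\<close> stands for \<open>ad(x)\<^sup>i y\<close>, where \<open>x\<close> is the eliminated letter.
  Coding the new letters by natural numbers keeps the type fixed, so that eliminations can be
  iterated.  The bracket with \<open>x\<close> becomes the derivation \<open>deriv\<close> that raises every index \<open>i\<close> by one.
\<close>

definition shift :: "nat \<Rightarrow> nat" where
  "shift m = (case prod_decode m of (y, i) \<Rightarrow> prod_encode (y, Suc i))"

primrec word_deriv :: "nat lie_word \<Rightarrow> (nat lie_word \<Rightarrow>\<^sub>0 int)" where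
  "word_deriv (Gen m) = frag_of (Gen (shift m))"
| "word_deriv (Br u v) = br (word_deriv u) (frag_of v) + br (frag_of u) (word_deriv v)"

definition deriv :: "(nat lie_word \<Rightarrow>\<^sub>0 int) \<Rightarrow> (nat lie_word \<Rightarrow>\<^sub>0 int)" where
  "deriv = frag_extend word_deriv"

lemma deriv_simps [simp]:
  "deriv 0 = 0" "deriv (p - q) = deriv p - deriv q" "deriv (p + q) = deriv p + deriv q"
  "deriv (frag_cmul c p) = frag_cmul c (deriv p)" "deriv (frag_of w) = word_deriv w"
  by (simp_all add: deriv_def frag_extend_diff frag_extend_add frag_extend_cmul)

lemma deriv_br: "deriv (br p q) = br (deriv p) q + br p (deriv q)"
  by (rule frag_biadditive_eqI[where f = "\<lambda>p q. deriv (br p q)"])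
    (simp_all add: br_diff_left br_diff_right)

lemma deriv_quasi2:
  assumes "p \<in> quasi2" shows "deriv p \<in> quasi2"
  using assms
proof induction
  case (anti p q)
  have "(br (deriv p) q + br q (deriv p)) + (br p (deriv q) + br (deriv q) p) \<in> quasi2"
    by (intro quasi2_add quasi2.anti)
  then show ?case by (simp add: deriv_br algebra_simps)
next
  case (jac p q s)
  have "(br (br (deriv p) q) s + br (br q s) (deriv p) + br (br s (deriv p)) q)
      + (br (br p (deriv q)) s + br (br (deriv q) s) p + br (br s p) (deriv q))
      + (br (br p q) (deriv s) + br (br q (deriv s)) p + br (br (deriv s) p) q) \<in> quasi2"
    by (intro quasi2_add quasi2.jac)
  then show ?case by (simp add: deriv_br br_add_left br_add_right algebra_simps)
next
  case (double p)
  show ?case using quasi2.double[of "deriv p"] by simp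
next
  case (diff p q)
  then show ?case using quasi2.diff by simp
next
  case (left p q)
  then show ?case
    using quasi2_add[OF quasi2.left[of p "deriv q"] quasi2.left[of "deriv p" q]] by (simp add: deriv_br)
qed

text \<open>
  Modulo \<open>x\<close> and \<open>[x, x]\<close>, every word is an expression in the letters \<open>ad(x)\<^sup>i y\<close>.  The definition
  computes in the semidirect product of the ring on these letters with the multiples of \<open>x\<close>, where
  \<open>x\<close> acts by \<open>deriv\<close> and \<open>[x, x] = 0\<close>, and drops the component along \<open>x\<close>.  The only word with a
  nonzero component along \<open>x\<close> is \<open>x\<close> itself.
\<close>

primrec word_elim :: "nat \<Rightarrow> nat lie_word \<Rightarrow> (nat lie_word \<Rightarrow>\<^sub>0 int)" where
  "word_elim x (Gen y) = (if y = x then 0 else frag_of (Gen (prod_encode (y, 0))))"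
| "word_elim x (Br u v) = br (word_elim x u) (word_elim x v)
     + (if u = Gen x then deriv (word_elim x v) else 0)
     - (if v = Gen x then deriv (word_elim x u) else 0)"

definition elim :: "nat \<Rightarrow> (nat lie_word \<Rightarrow>\<^sub>0 int) \<Rightarrow> (nat lie_word \<Rightarrow>\<^sub>0 int)" where
  "elim x = frag_extend (word_elim x)"

lemma elim_simps [simp]:
  "elim x 0 = 0" "elim x (p - q) = elim x p - elim x q" "elim x (p + q) = elim x p + elim x q"
  "elim x (frag_of w) = word_elim x w"
  by (simp_all add: elim_def frag_extend_diff frag_extend_add)

text \<open>
  The bracket of the semidirect product; the coefficient of \<open>Gen x\<close> is the component along \<open>x\<close>.
\<close>

lemma elim_br:
  "elim x (br p q) = br (elim x p) (elim x q)
     + frag_cmul (Poly_Mapping.lookup p (Gen x)) (deriv (elim x q))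
     - frag_cmul (Poly_Mapping.lookup q (Gen x)) (deriv (elim x p))"
  by (rule frag_biadditive_eqI[where f = "\<lambda>p q. elim x (br p q)"])
    (simp_all add: br_diff_left br_diff_right lookup_minus frag_cmul_diff2 frag_cmul_diff_distrib
      lookup_frag_of)

text \<open>
  The semidirect product is a quasi-Lie ring: in the Jacobi sum, the terms with one factor \<open>x\<close>
  cancel by the derivation rule and antisymmetry, the terms with two factors \<open>x\<close> cancel outright.
  Elements of the ideal have an even component along \<open>x\<close>, so dropping it preserves the closure
  under brackets.
\<close>

lemma elim_quasi2:
  assumes "p \<in> quasi2" shows "elim x p \<in> quasi2"
  using assms
proof induction
  case (anti p q)
  have "elim x (br p q + br q p) = br (elim x p) (elim x q) + br (elim x q) (elim x p)"
    by (simp add: elim_br)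
  then show ?case using quasi2.anti by metis
next
  case (jac p q s)
  define P Q S where PQS: "P = elim x p" "Q = elim x q" "S = elim x s"
  define a b c where abc: "a = Poly_Mapping.lookup p (Gen x)" "b = Poly_Mapping.lookup q (Gen x)"
    "c = Poly_Mapping.lookup s (Gen x)"
  have "elim x (br (br p q) s + br (br q s) p + br (br s p) q)
    = (br (br P Q) S + br (br Q S) P + br (br S P) Q)
      - frag_cmul c (br P (deriv Q) + br (deriv Q) P)
      - frag_cmul a (br Q (deriv S) + br (deriv S) Q)
      - frag_cmul b (br S (deriv P) + br (deriv P) S)"
    by (simp add: elim_br deriv_br lookup_br_Gen PQS[symmetric] abc[symmetric] br_add_left
        br_add_right br_diff_left br_diff_right br_cmul_left br_cmul_right frag_cmul_distrib2
        frag_cmul_diff2 mult.commute del: minus_frag_cmul)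
  also have "\<dots> \<in> quasi2"
    by (intro quasi2.diff quasi2_cmul quasi2.jac quasi2.anti)
  finally show ?case .
next
  case (left p q)
  obtain y where y: "frag_cmul (Poly_Mapping.lookup p (Gen x)) (deriv (elim x q)) = y + y"
    using frag_cmul_even[OF quasi2_even_linear[OF left(1)]] by blast
  then show ?case
    using quasi2.diff[OF quasi2_add[OF quasi2.left[OF left(2)] quasi2_cmul[OF deriv_quasi2[OF left(2)]]]
        quasi2.double[of y]]
    by (simp add: elim_br y)
next
  case (double p)
  show ?case using quasi2.double[of "elim x p"] by simp
next
  case (diff p q)
  then show ?case using quasi2.diff by simp
qed

definition unelim_gen :: "nat \<Rightarrow> nat \<Rightarrow> (nat lie_word \<Rightarrow>\<^sub>0 int)" where
  "unelim_gen x m = (case prod_decode m of (y, i) \<Rightarrow>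
     if y = x then 0 else (br (frag_of (Gen x)) ^^ i) (frag_of (Gen y)))"

abbreviation unelim :: "nat \<Rightarrow> (nat lie_word \<Rightarrow>\<^sub>0 int) \<Rightarrow> (nat lie_word \<Rightarrow>\<^sub>0 int)" where
  "unelim x \<equiv> substitute (unelim_gen x)"

text \<open>
  The Jacobi identity in the form that \<open>ad(p)\<close> is a derivation.
\<close>

lemma lie2_derivation: "br p (br q s) - (br (br p q) s + br q (br p s)) \<in> lie2"
proof -
  have "br (br p s) q + br q (br p s) \<in> lie2" "br (br q s) p + br p (br q s) \<in> lie2"
    "br (br p s + br s p) q \<in> lie2"
    using lie2_anti lie2_right by blast+
  moreover note lie2.jac[of p q s]
  ultimately have "(br (br q s) p + br p (br q s)) - (br (br p q) s + br (br q s) p + br (br s p) q)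
      + br (br p s + br s p) q - (br (br p s) q + br q (br p s)) \<in> lie2"
    by - (assumption | rule lie2.diff lie2_add)+
  then show ?thesis by (simp add: br_add_left algebra_simps)
qed

text \<open>
  Modulo the Lie relations, both terms are derivations along \<open>unelim x\<close>, so it suffices to compare
  them on the letters \<open>y\<^sub>i\<close>, where they are equal by the definition of \<open>unelim_gen\<close>.  The letters coded by
  \<open>(x, i)\<close> never arise from \<open>elim\<close>; they go to zero.
\<close>

lemma unelim_deriv: "unelim x (deriv p) - br (frag_of (Gen x)) (unelim x p) \<in> lie2"
proof -
  let ?e = "\<lambda>p. unelim x (deriv p) - br (frag_of (Gen x)) (unelim x p)"
  have w: "?e (frag_of w) \<in> lie2" for w
  proof (induction w)
    case (Gen m)
    then show ?case
      by (simp add: unelim_gen_def shift_def lie2_zero split: prod.split)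
  next
    case (Br u v)
    let ?U = "unelim x (frag_of u)" and ?V = "unelim x (frag_of v)"
    note lie2_right[OF Br(1), of ?V] lie2.left[OF Br(2), of ?U]
      lie2_derivation[of "frag_of (Gen x)" ?U ?V]
    then have "br (?e (frag_of u)) ?V + br ?U (?e (frag_of v))
        - (br (frag_of (Gen x)) (br ?U ?V)
          - (br (br (frag_of (Gen x)) ?U) ?V + br ?U (br (frag_of (Gen x)) ?V))) \<in> lie2"
      by - (assumption | rule lie2.diff lie2_add)+
    moreover have "unelim x (frag_of (Br u v)) = br ?U ?V"
      using substitute_br[of _ "frag_of u" "frag_of v"] by simp
    ultimately show ?case
      by (simp add: br_diff_left br_diff_right algebra_simps)
  qed
  have "Poly_Mapping.keys p \<subseteq> UNIV" by simp
  then show ?thesis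
  proof (induction p rule: frag_induct)
    case (diff a b)
    from lie2.diff[OF diff(3,4)] show ?case by (simp add: br_diff_right algebra_simps)
  qed (use w lie2_zero in simp_all)
qed

text \<open>
  Elimination loses only the component along \<open>x\<close>.  Working modulo \<open>lie2\<close> and not modulo \<open>quasi2\<close>
  is essential, since \<open>[x, x]\<close> is lost as well.
\<close>

lemma unelim_elim:
  "unelim x (elim x p) + frag_cmul (Poly_Mapping.lookup p (Gen x)) (frag_of (Gen x)) - p \<in> lie2"
proof -
  let ?X = "frag_of (Gen x)"
  let ?c = "\<lambda>p. Poly_Mapping.lookup p (Gen x)"
  let ?e = "\<lambda>p. unelim x (elim x p) + frag_cmul (?c p) ?X - p"
  have w: "?e (frag_of w) \<in> lie2" for w
  proof (induction w)
    case (Gen m)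
    then show ?case
      by (simp add: unelim_gen_def lookup_frag_of lie2_zero)
  next
    case (Br u v)
    define p q where pq: "p = frag_of u" "q = frag_of v"
    let ?P = "unelim x (elim x p)" and ?Q = "unelim x (elim x q)"
    define a b where ab: "a = ?c p" "b = ?c q"
    \<comment> \<open>The coefficients \<open>a\<close> and \<open>b\<close> of \<open>x\<close> in words are zero or one.\<close>
    have cm: "z \<in> lie2 \<Longrightarrow> frag_cmul a z \<in> lie2" "z \<in> lie2 \<Longrightarrow> frag_cmul b z \<in> lie2" for z
      by (simp_all add: ab pq lookup_frag_of lie2_zero)
    have cm2: "z \<in> lie2 \<Longrightarrow> frag_cmul (a * b) z \<in> lie2" for z
      using cm(1)[OF cm(2)[of z]] by simp
    have e: "?e p \<in> lie2" "?e q \<in> lie2" using Br pq by simp_all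
    note lie2_right[OF e(1), of "?e q"] lie2_right[OF e(1), of q] lie2.left[OF e(2), of p]
      cm(1)[OF unelim_deriv[of x "elim x q"]] cm(2)[OF unelim_deriv[of x "elim x p"]]
      cm(2)[OF lie2_anti[of ?P ?X]] cm2[OF lie2.self[of ?X]]
    then have *: "br (?e p) (?e q) + br (?e p) q + br p (?e q)
       + frag_cmul a (unelim x (deriv (elim x q)) - br ?X ?Q)
       - frag_cmul b (unelim x (deriv (elim x p)) - br ?X ?P)
       - frag_cmul b (br ?P ?X + br ?X ?P)
       - frag_cmul (a * b) (br ?X ?X) \<in> lie2"
      by - (assumption | rule lie2.diff lie2_add)+
    have pqw: "frag_of (Br u v) = br p q" by (simp add: pq)
    have sc: "substitute f (frag_cmul a z) = frag_cmul a (substitute f z)"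
      for f :: "nat \<Rightarrow> nat lie_word \<Rightarrow>\<^sub>0 int" and a z
      by (simp add: substitute_def frag_extend_cmul)
    have E: "?e p = ?P + frag_cmul a ?X - p" "?e q = ?Q + frag_cmul b ?X - q"
      by (simp_all only: ab)
    \<comment> \<open>Expand \<open>[P + a x, Q + b x]\<close>, which is congruent to \<open>[p, q]\<close>; the bracket has no component
      along \<open>x\<close>.\<close>
    have "unelim x (elim x (br p q)) + frag_cmul (?c (br p q)) ?X - br p q =
       br (?e p) (?e q) + br (?e p) q + br p (?e q)
       + frag_cmul a (unelim x (deriv (elim x q)) - br ?X ?Q)
       - frag_cmul b (unelim x (deriv (elim x p)) - br ?X ?P)
       - frag_cmul b (br ?P ?X + br ?X ?P)
       - frag_cmul (a * b) (br ?X ?X)"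
      unfolding E
      by (simp add: ab[symmetric] elim_br sc lookup_br_Gen br_add_left br_add_right br_diff_left
          br_diff_right br_cmul_left br_cmul_right frag_cmul_diff2 frag_cmul_distrib2
          mult.commute del: minus_frag_cmul br_frag_of)
    then show ?case using * pqw by simp
  qed
  have "Poly_Mapping.keys p \<subseteq> UNIV" by simp
  then show ?thesis
  proof (induction p rule: frag_induct)
    case (diff a b)
    from lie2.diff[OF diff(3,4)] show ?case
      by (simp add: lookup_minus frag_cmul_diff_distrib algebra_simps)
  qed (use w lie2_zero in simp_all)
qed

lemma elim_reflects_lie2:
  assumes "br p p \<in> quasi2" "elim x p \<in> lie2"
  shows "p \<in> lie2"
proof -
  obtain y where "frag_cmul (Poly_Mapping.lookup p (Gen x)) (frag_of (Gen x)) = y + y"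
    using frag_cmul_even[OF square_quasi2_even[OF assms(1)]] by blast
  then have "frag_cmul (Poly_Mapping.lookup p (Gen x)) (frag_of (Gen x)) \<in> lie2"
    by (metis lie2.double)
  from lie2.diff[OF lie2_add[OF substitute_lie2[OF assms(2), of "unelim_gen x"] this]
      unelim_elim[of x p]]
  show ?thesis by simp
qed

lemma keys_word_deriv: "w' \<in> Poly_Mapping.keys (word_deriv w) \<Longrightarrow> weight w' = weight w"
proof (induction w arbitrary: w')
  case (Br u v)
  have "Poly_Mapping.keys (br (word_deriv u) (frag_of v)) \<subseteq> {w. weight w = weight u + weight v}"
    "Poly_Mapping.keys (br (frag_of u) (word_deriv v)) \<subseteq> {w. weight w = weight u + weight v}"
    by (rule br_keys[where U = "{w. weight w = weight u}" and V = "{w. weight w = weight v}"];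
        use Br.IH in auto)+
  then show ?case using Br.prems keys_add by fastforce
qed auto

lemma keys_deriv:
  "Poly_Mapping.keys p \<subseteq> {w. weight w \<le> n} \<Longrightarrow> Poly_Mapping.keys (deriv p) \<subseteq> {w. weight w \<le> n}"
  unfolding deriv_def using keys_frag_extend[of word_deriv p] keys_word_deriv by fastforce

text \<open>
  The termination measure of the elimination: words do not get longer, and a word that keeps its
  length has lost the letter \<open>x\<close> and has only letters with index \<open>0\<close>.
\<close>

definition elim_bound :: "nat \<Rightarrow> nat lie_word \<Rightarrow> nat lie_word set" where
  "elim_bound x w = {w'. weight w' \<le> weight w \<and> (weight w' = weight w \<longrightarrow>
     set_lie_word w' \<subseteq> (\<lambda>y. prod_encode (y, 0)) ` (set_lie_word w - {x}))}"

lemma keys_word_elim: "Poly_Mapping.keys (word_elim x w) \<subseteq> elim_bound x w"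
proof (induction w)
  case (Br u v)
  have 1: "Poly_Mapping.keys (br (word_elim x u) (word_elim x v)) \<subseteq> elim_bound x (Br u v)"
    by (rule br_keys[OF Br.IH]) (fastforce simp: elim_bound_def)
  have 2: "Poly_Mapping.keys (deriv (word_elim x v)) \<subseteq> elim_bound x (Br u v)" if "u = Gen x"
    using keys_deriv[of "word_elim x v" "weight v"] Br.IH(2) that
    by (fastforce simp: elim_bound_def)
  have 3: "Poly_Mapping.keys (deriv (word_elim x u)) \<subseteq> elim_bound x (Br u v)" if "v = Gen x"
    using keys_deriv[of "word_elim x u" "weight u"] Br.IH(1) that
    by (fastforce simp: elim_bound_def)
  show ?case
    using 1 2 3 by (auto dest!: set_mp[OF keys_diff] set_mp[OF keys_add])
qed (auto simp: elim_bound_def)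

lemma set_lie_word_nonempty: "set_lie_word w \<noteq> {}"
  by (induction w) auto

lemma finite_set_lie_word: "finite (set_lie_word w)"
  by (induction w) auto

lemma weight_pos: "weight w > 0"
  by (induction w) auto

text \<open>
  Induction on the maximal weight \<open>n\<close> of the words in \<open>p\<close>, and for fixed \<open>n\<close> on the number of letters
  that occur in the words of weight \<open>n\<close>.  Eliminating one of these letters makes their number
  smaller.  When none is left there is no word of weight \<open>n\<close>, since every word contains a letter.
\<close>

theorem square_quasi2_imp_lie2:
  fixes p :: "nat lie_word \<Rightarrow>\<^sub>0 int"
  assumes "br p p \<in> quasi2"
  shows "p \<in> lie2"
proof -
  let ?bounded = "\<lambda>p n S. Poly_Mapping.keys p \<subseteq>
      {w. weight w \<le> n \<and> (weight w = n \<longrightarrow> set_lie_word w \<subseteq> S)}"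
  let ?letters = "\<lambda>p. \<Union> (set_lie_word ` Poly_Mapping.keys p)"
  have fin: "finite (?letters p)" for p :: "nat lie_word \<Rightarrow>\<^sub>0 int"
    by (simp add: finite_set_lie_word)
  have "\<lbrakk>br p p \<in> quasi2; finite S; ?bounded p n S\<rbrakk> \<Longrightarrow> p \<in> lie2"
    for n S and p :: "nat lie_word \<Rightarrow>\<^sub>0 int"
  proof (induction n arbitrary: p S)
    case 0
    have "w \<notin> Poly_Mapping.keys p" for w
      using 0(3) weight_pos[of w] by auto
    then have "p = 0" by (metis all_not_in_conv keys_eq_empty)
    then show ?case by (simp add: lie2_zero)
  next
    case (Suc n)
    show ?case
      using Suc.prems(2,1,3)
    proof (induction S arbitrary: p rule: measure_induct_rule[where f = card])
      case (less S)
      show ?case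
      proof (cases "S = {}")
        case True
        then have "?bounded p n (?letters p)"
          using less.prems(3) set_lie_word_nonempty le_Suc_eq by fastforce
        then show ?thesis using Suc.IH[OF less.prems(2) fin] by blast
      next
        case False
        then obtain x where x: "x \<in> S" by blast
        let ?S = "(\<lambda>y. prod_encode (y, 0)) ` (S - {x})"
        have "card ?S \<le> card (S - {x})" using less.prems(1) by (intro card_image_le) simp
        also have "\<dots> < card S" using x less.prems(1) by (meson card_Diff1_less)
        finally have card: "card ?S < card S" .
        have sq: "br (elim x p) (elim x p) \<in> quasi2"
          using elim_quasi2[OF less.prems(2), of x] by (simp add: elim_br)
        have "?bounded (elim x p) (Suc n) ?S"
        proof
          fix w' assume "w' \<in> Poly_Mapping.keys (elim x p)"
          then obtain w where w: "w \<in> Poly_Mapping.keys p" "w' \<in> elim_bound x w"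
            unfolding elim_def using keys_frag_extend keys_word_elim by fast
          then show "w' \<in> {w. weight w \<le> Suc n \<and> (weight w = Suc n \<longrightarrow> set_lie_word w \<subseteq> ?S)}"
            using less.prems(3) unfolding elim_bound_def by fastforce
        qed
        then have "elim x p \<in> lie2"
          using less.IH[OF card _ sq] less.prems(1) by simp
        then show ?thesis by (rule elim_reflects_lie2[OF less.prems(2)])
      qed
    qed
  qed
  moreover obtain n where "\<And>w. w \<in> Poly_Mapping.keys p \<Longrightarrow> weight w \<le> n"
    using finite_nat_set_iff_bounded_le[of "weight ` Poly_Mapping.keys p"] by auto
  then have "?bounded p n (?letters p)" by blast
  ultimately show ?thesis using assms fin by blast
qed


section \<open>Homogeneous components of the defining ideals\<close>

definition degree_part :: "nat \<Rightarrow> ('h lie_word \<Rightarrow>\<^sub>0 int) \<Rightarrow> ('h lie_word \<Rightarrow>\<^sub>0 int)" where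
  "degree_part n = frag_extend (\<lambda>w. if weight w = n then frag_of w else 0)"

lemma degree_part_simps [simp]:
  "degree_part n 0 = 0" "degree_part n (x - y) = degree_part n x - degree_part n y"
  "degree_part n (x + y) = degree_part n x + degree_part n y"
  "degree_part n (frag_of w) = (if weight w = n then frag_of w else 0)"
  by (simp_all add: degree_part_def frag_extend_diff frag_extend_add)

lemma keys_degree_part:
  "Poly_Mapping.keys (degree_part n x) \<subseteq> {w \<in> Poly_Mapping.keys x. weight w = n}"
  unfolding degree_part_def by (rule order_trans[OF keys_frag_extend]) (auto split: if_splits)

lemma degree_part_eq:
  assumes "Poly_Mapping.keys x \<subseteq> {w. weight w = n}"
  shows "degree_part n x = x"
  by (rule frag_eqI[OF assms, where g = "\<lambda>x. x"]) simp_all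

lemma degree_part_br_left:
  "degree_part n (br (frag_of u) x)
     = (if weight u \<le> n then br (frag_of u) (degree_part (n - weight u) x) else 0)"
proof (rule frag_eqI[where S = UNIV and f = "\<lambda>x. degree_part n (br (frag_of u) x)"])
  show "degree_part n (br (frag_of u) (frag_of w))
     = (if weight u \<le> n then br (frag_of u) (degree_part (n - weight u) (frag_of w)) else 0)" for w
    by auto
qed (simp_all add: br_diff_right)

lemma degree_part_br_right:
  "degree_part n (br x (frag_of u))
     = (if weight u \<le> n then br (degree_part (n - weight u) x) (frag_of u) else 0)"
proof (rule frag_eqI[where S = UNIV and f = "\<lambda>x. degree_part n (br x (frag_of u))"])
  show "degree_part n (br (frag_of w) (frag_of u))
     = (if weight u \<le> n then br (degree_part (n - weight u) (frag_of w)) (frag_of u) else 0)" for w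
    by auto
qed (simp_all add: br_diff_left)

text \<open>
  The relators are multilinear; this reduces statements about them to statements about words, which
  are homogeneous.
\<close>

lemma additive_in_ideal:
  fixes f :: "('a \<Rightarrow>\<^sub>0 int) \<Rightarrow> ('h lie_word \<Rightarrow>\<^sub>0 int)"
  assumes "x \<in> carrier (free_Abelian_group S)"
    and add: "\<And>a b. f (a - b) = f a - f b"
    and words: "\<And>w. w \<in> S \<Longrightarrow> f (frag_of w) \<in> nonassoc_ideal H R"
  shows "f x \<in> nonassoc_ideal H R"
proof -
  have "Poly_Mapping.keys x \<subseteq> S" using assms(1) by simp
  then show ?thesis
  proof (induction x rule: frag_induct)
    case zero
    show ?case using add[of 0 0] by (simp add: nonassoc_ideal.zero)
  qed (simp_all add: add words nonassoc_ideal.diff)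
qed

lemma quasi_lie_ideal_anti:
  "\<lbrakk>x \<in> carrier (nonassoc H); y \<in> carrier (nonassoc H)\<rbrakk>
    \<Longrightarrow> br x y + br y x \<in> nonassoc_ideal H (quasi_lie_relators H)"
  by (rule nonassoc_ideal.base) (auto simp: quasi_lie_relators_def)

lemma quasi_lie_ideal_jacobi:
  "\<lbrakk>x \<in> carrier (nonassoc H); y \<in> carrier (nonassoc H); z \<in> carrier (nonassoc H)\<rbrakk>
    \<Longrightarrow> br (br x y) z + br (br y z) x + br (br z x) y \<in> nonassoc_ideal H (quasi_lie_relators H)"
  unfolding quasi_lie_relators_def by (rule nonassoc_ideal.base) blast

lemma quasi_lie_ideal_gen:
  "\<lbrakk>a \<in> carrier H; b \<in> carrier H\<rbrakk> \<Longrightarrow> frag_of (Gen (a \<otimes>\<^bsub>H\<^esub> b)) - (frag_of (Gen a) + frag_of (Gen b))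
    \<in> nonassoc_ideal H (quasi_lie_relators H)"
  unfolding quasi_lie_relators_def by (rule nonassoc_ideal.base) blast

lemma quasi_lie_ideal_homogeneous:
  assumes "x \<in> nonassoc_ideal H (quasi_lie_relators H)"
  shows "degree_part n x \<in> nonassoc_ideal H (quasi_lie_relators H)"
  using assms
proof (induction arbitrary: n)
  case (base r)
  let ?I = "nonassoc_ideal H (quasi_lie_relators H)"
  have word: "w \<in> lie_words H \<Longrightarrow> frag_of w \<in> carrier (nonassoc H)" for w by simp
  from base consider
      (gen) a b where "a \<in> carrier H" "b \<in> carrier H"
        "r = frag_of (Gen (a \<otimes>\<^bsub>H\<^esub> b)) - (frag_of (Gen a) + frag_of (Gen b))"
    | (anti) x y where "x \<in> carrier (nonassoc H)" "y \<in> carrier (nonassoc H)"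
        "r = br x y + br y x"
    | (jac) x y z where "x \<in> carrier (nonassoc H)" "y \<in> carrier (nonassoc H)"
        "z \<in> carrier (nonassoc H)" "r = br (br x y) z + br (br y z) x + br (br z x) y"
    unfolding quasi_lie_relators_def by blast
  then show ?case
  proof cases
    case gen
    then show ?thesis
      using quasi_lie_ideal_gen[of a H b] by (simp add: nonassoc_ideal.zero)
  next
    case anti
    have "degree_part n (br (frag_of u) (frag_of v) + br (frag_of v) (frag_of u)) \<in> ?I"
      if "u \<in> lie_words H" "v \<in> lie_words H" for u v
      using quasi_lie_ideal_anti[OF word[OF that(1)] word[OF that(2)]]
      by (simp add: nonassoc_ideal.zero add.commute[where 'a = nat])
    then have "degree_part n (br (frag_of u) y + br y (frag_of u)) \<in> ?I"
      if "u \<in> lie_words H" for u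
      using that by - (rule additive_in_ideal[OF anti(2)]; simp add: br_diff_left br_diff_right)
    then show ?thesis
      unfolding anti(3)
      by - (rule additive_in_ideal[OF anti(1)]; simp add: br_diff_left br_diff_right)
  next
    case jac
    let ?j = "\<lambda>x y z. degree_part n (br (br x y) z + br (br y z) x + br (br z x) y)"
    \<comment> \<open>On words the relator is homogeneous, so its component is the relator or zero.\<close>
    have "?j (frag_of u) (frag_of v) (frag_of w) \<in> ?I"
      if "u \<in> lie_words H" "v \<in> lie_words H" "w \<in> lie_words H" for u v w
      using quasi_lie_ideal_jacobi[OF word[OF that(1)] word[OF that(2)] word[OF that(3)]]
      by (simp add: nonassoc_ideal.zero add.commute[where 'a = nat] add.left_commute[where 'a = nat])
    then have "?j (frag_of u) (frag_of v) z \<in> ?I" if "u \<in> lie_words H" "v \<in> lie_words H" for u v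
      using that by - (rule additive_in_ideal[OF jac(3)]; simp add: br_diff_left br_diff_right)
    then have "?j (frag_of u) y z \<in> ?I" if "u \<in> lie_words H" for u
      using that by - (rule additive_in_ideal[OF jac(2)]; simp add: br_diff_left br_diff_right)
    then show ?thesis
      unfolding jac(4)
      by - (rule additive_in_ideal[OF jac(1)]; simp add: br_diff_left br_diff_right)
  qed
next
  case (left x y)
  show ?case
    by (rule additive_in_ideal[OF left(2)])
      (simp_all add: br_diff_left degree_part_br_left nonassoc_ideal.zero nonassoc_ideal.left left(3))
next
  case (right x y)
  show ?case
    by (rule additive_in_ideal[OF right(2)])
      (simp_all add: br_diff_right degree_part_br_right nonassoc_ideal.zero nonassoc_ideal.right right(3))
qed (simp_all add: nonassoc_ideal.zero nonassoc_ideal.diff)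

text \<open>
  Let \<open>K\<close> be the set of all sums of an element of \<open>I\<close> and a square \<open>[y, y]\<close> of weight \<open>n\<close>.  It is a
  subgroup because squares are additive modulo \<open>I\<close>, and it absorbs the components of the further
  brackets of squares because those lie in \<open>I\<close>.  The components of mixed weight of a square \<open>[x, x]\<close>
  come in antisymmetric pairs, so they vanish modulo \<open>I\<close> as well.  When \<open>n\<close> is odd, \<open>y\<close> is zero.
\<close>

lemma lie_ideal_degree_part:
  assumes "monoid H" "x \<in> nonassoc_ideal H (lie_relators H)"
  shows "\<exists>y. Poly_Mapping.keys y \<subseteq> {w \<in> lie_words H. 2 * weight w = n}
     \<and> degree_part n x - br y y \<in> nonassoc_ideal H (quasi_lie_relators H)"
proof -
  let ?I = "nonassoc_ideal H (quasi_lie_relators H)"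
  define K where "K = {z. \<exists>y. Poly_Mapping.keys y \<subseteq> {w \<in> lie_words H. 2 * weight w = n}
     \<and> z - br y y \<in> ?I}"
  have IK: "z \<in> K" if "z \<in> ?I" for z
    unfolding K_def using that by (intro CollectI exI[where x = 0]) simp
  have K_diff: "z - z' \<in> K" if K: "z \<in> K" "z' \<in> K" for z z'
  proof -
    obtain y y' where y: "Poly_Mapping.keys y \<subseteq> {w \<in> lie_words H. 2 * weight w = n}" "z - br y y \<in> ?I"
      and y': "Poly_Mapping.keys y' \<subseteq> {w \<in> lie_words H. 2 * weight w = n}" "z' - br y' y' \<in> ?I"
      using K unfolding K_def by blast
    have c: "y \<in> carrier (nonassoc H)" "y' \<in> carrier (nonassoc H)" using y y' by auto
    have "(z - br y y) - (z' - br y' y') + (br y y' + br y' y) - (br y' y' + br y' y') \<in> ?I"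
      by (rule nonassoc_ideal.diff[OF nonassoc_ideal_add[OF nonassoc_ideal.diff[OF y(2) y'(2)]]
            quasi_lie_ideal_anti[OF c(2,2)]]) (rule quasi_lie_ideal_anti[OF c])
    moreover have "Poly_Mapping.keys (y - y') \<subseteq> {w \<in> lie_words H. 2 * weight w = n}"
      using y(1) y'(1) keys_diff[of y y'] by blast
    ultimately show ?thesis
      unfolding K_def
      by (intro CollectI exI[where x = "y - y'"]) (simp add: br_diff_left br_diff_right algebra_simps)
  qed
  have "degree_part n x \<in> K"
    using assms(2)
  proof induction
    case (base r)
    then consider "r \<in> quasi_lie_relators H"
      | x where "x \<in> carrier (nonassoc H)" "r = br x x"
      unfolding lie_relators_def by blast
    then show ?case
    proof cases
      case 1
      then show ?thesis
        by (intro IK quasi_lie_ideal_homogeneous nonassoc_ideal.base)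
    next
      case 2
      have "Poly_Mapping.keys x \<subseteq> lie_words H" using 2 by simp
      then have "degree_part n (br x x) \<in> K"
      proof (induction x rule: frag_induct)
        case zero
        show ?case by (simp add: IK nonassoc_ideal.zero)
      next
        case (diff a b)
        have c: "a \<in> carrier (nonassoc H)" "b \<in> carrier (nonassoc H)" using diff by auto
        have "(br a b + br b a) - (br b b + br b b) \<in> ?I"
          using c by (intro nonassoc_ideal.diff quasi_lie_ideal_anti)
        from K_diff[OF K_diff[OF diff(3,4)] IK[OF quasi_lie_ideal_homogeneous[OF this, of n]]]
        show ?case by (simp add: br_diff_left br_diff_right algebra_simps)
      next
        case (gen w)
        show ?case
        proof (cases "2 * weight w = n")
          case True
          then have "degree_part n (br (frag_of w) (frag_of w)) - br (frag_of w) (frag_of w) \<in> ?I"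
            by (simp add: nonassoc_ideal.zero)
          then show ?thesis
            unfolding K_def using True gen by (intro CollectI exI[of _ "frag_of w"]) simp
        next
          case False
          then show ?thesis by (simp add: IK nonassoc_ideal.zero mult_2)
        qed
      qed
      then show ?thesis using 2 by simp
    qed
  next
    case zero
    show ?case by (simp add: IK nonassoc_ideal.zero)
  next
    case (diff x y)
    then show ?case using K_diff by simp
  next
    case (left x y)
    have "x \<in> carrier (nonassoc H)"
      using nonassoc_ideal_subset[OF lie_relators_subset[OF assms(1)]] left(1) by blast
    from nonassoc_ideal.diff[OF quasi_lie_ideal_anti[OF left(2) this]
        lie_relators_ideal_central[OF assms(1) left(1,2)]]
    have "br y x \<in> ?I" by simp
    then show ?case by (intro IK quasi_lie_ideal_homogeneous)
  next
    case (right x y)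
    then show ?case
      by (intro IK quasi_lie_ideal_homogeneous lie_relators_ideal_central assms(1))
  qed
  then show ?thesis unfolding K_def by blast
qed

lemma quasi_lie_ideal_subset_lie_ideal:
  "nonassoc_ideal H (quasi_lie_relators H) \<subseteq> nonassoc_ideal H (lie_relators H)"
  by (rule nonassoc_ideal_mono) (simp add: lie_relators_def)

lemma lie_ideal_square:
  "x \<in> carrier (nonassoc H) \<Longrightarrow> br x x \<in> nonassoc_ideal H (lie_relators H)"
  unfolding lie_relators_def by (rule nonassoc_ideal.base) blast

lemma lie_ideal_homogeneous:
  assumes "monoid H" "x \<in> nonassoc_ideal H (lie_relators H)"
  shows "degree_part n x \<in> nonassoc_ideal H (lie_relators H)"
proof -
  obtain y where y: "Poly_Mapping.keys y \<subseteq> {w \<in> lie_words H. 2 * weight w = n}"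
    "degree_part n x - br y y \<in> nonassoc_ideal H (quasi_lie_relators H)"
    using lie_ideal_degree_part[OF assms] by blast
  have "degree_part n x - br y y \<in> nonassoc_ideal H (lie_relators H)"
    using y(2) by (rule subsetD[OF quasi_lie_ideal_subset_lie_ideal])
  moreover have "br y y \<in> nonassoc_ideal H (lie_relators H)"
    using y(1) by (intro lie_ideal_square) auto
  ultimately have "(degree_part n x - br y y) + br y y \<in> nonassoc_ideal H (lie_relators H)"
    by (rule nonassoc_ideal_add)
  then show ?thesis by simp
qed


section \<open>Divisibility of squares in the free quasi-Lie algebra on an abelian group\<close>

text \<open>
  An additive \<open>f\<close> annihilates the additivity relators, and every substitution preserves the others.
\<close>

lemma substitute_quasi_lie_ideal:
  assumes f: "\<And>a b. \<lbrakk>a \<in> carrier H; b \<in> carrier H\<rbrakk> \<Longrightarrow> f (a \<otimes>\<^bsub>H\<^esub> b) = f a + f b"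
    and x: "x \<in> nonassoc_ideal H (quasi_lie_relators H)"
  shows "substitute f x \<in> quasi2"
  using x
proof induction
  case (base r)
  then consider
      (gen) a b where "a \<in> carrier H" "b \<in> carrier H"
        "r = frag_of (Gen (a \<otimes>\<^bsub>H\<^esub> b)) - (frag_of (Gen a) + frag_of (Gen b))"
    | (anti) x y where "r = br x y + br y x"
    | (jac) x y z where "r = br (br x y) z + br (br y z) x + br (br z x) y"
    unfolding quasi_lie_relators_def by blast
  then show ?case
    by cases (simp_all add: f quasi2_zero quasi2.anti quasi2.jac)
qed (simp_all add: quasi2_zero quasi2.diff quasi2.left quasi2_right)

lemma substitute_closed:
  assumes "\<And>y. g y \<in> carrier (nonassoc H)"
  shows "substitute g x \<in> carrier (nonassoc H)"
proof -
  have "word_subst g w \<in> carrier (nonassoc H)" for w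
    by (induction w) (use assms in \<open>auto simp del: carrier_free_Abelian_group_iff intro: br_closed\<close>)
  then show ?thesis
    unfolding substitute_def using keys_frag_extend[of "word_subst g" x] by fastforce
qed

lemma substitute_lie2_ideal:
  assumes g: "\<And>y. g y \<in> carrier (nonassoc H)" and x: "x \<in> lie2"
  shows "\<exists>j \<in> nonassoc_ideal H (lie_relators H). \<exists>c \<in> carrier (nonassoc H).
     substitute g x = j + (c + c)"
  using x
proof induction
  case (double p)
  show ?case
    using substitute_closed[OF g, where x = p]
    by (intro bexI[where x = 0] bexI[where x = "substitute g p"]) (simp_all add: nonassoc_ideal.zero)
next
  case (self p)
  have "br (substitute g p) (substitute g p) \<in> nonassoc_ideal H (lie_relators H)"
    by (rule lie_ideal_square[OF substitute_closed[OF g]])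
  then show ?case
    by (intro bexI[where x = "substitute g (br p p)"] bexI[where x = 0]) simp_all
next
  case (jac p q s)
  let ?r = "br (br p q) s + br (br q s) p + br (br s p) q"
  have "substitute g ?r
      \<in> nonassoc_ideal H (lie_relators H)"
    using subsetD[OF quasi_lie_ideal_subset_lie_ideal quasi_lie_ideal_jacobi[OF
          substitute_closed[OF g, where x = p] substitute_closed[OF g, where x = q]
          substitute_closed[OF g, where x = s]]] by simp
  then show ?case
    by (intro bexI[where x = "substitute g ?r"] bexI[where x = 0]) simp_all
next
  case (diff p q)
  then obtain j c j' c' where
    "j \<in> nonassoc_ideal H (lie_relators H)" "c \<in> carrier (nonassoc H)"
    "j' \<in> nonassoc_ideal H (lie_relators H)" "c' \<in> carrier (nonassoc H)"
    "substitute g p = j + (c + c)" "substitute g q = j' + (c' + c')" by blast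
  then show ?case
    using nonassoc_ideal.diff[of j H "lie_relators H" j'] frag_diff_closed[of c "lie_words H" c']
    by (intro bexI[where x = "j - j'"] bexI[where x = "c - c'"]) simp_all
next
  case (left p q)
  then obtain j c where jc:
    "j \<in> nonassoc_ideal H (lie_relators H)" "c \<in> carrier (nonassoc H)"
    "substitute g p = j + (c + c)" by blast
  have q: "substitute g q \<in> carrier (nonassoc H)" by (rule substitute_closed[OF g])
  show ?case
    using nonassoc_ideal.left[OF jc(1) q] br_closed[OF q jc(2)] jc(3)
    by (intro bexI[where x = "br (substitute g q) j"] bexI[where x = "br (substitute g q) c"])
      (simp_all add: br_add_right)
qed

lemma substitute_inverse_mod_ideal:
  assumes f: "\<And>h. h \<in> carrier H \<Longrightarrow> f h - frag_of (Gen h) \<in> nonassoc_ideal H R"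
    and R: "R \<subseteq> carrier (nonassoc H)"
    and x: "x \<in> carrier (nonassoc H)"
  shows "substitute f x - x \<in> nonassoc_ideal H R"
proof (rule additive_in_ideal[OF x])
  fix w assume "w \<in> lie_words H"
  then show "substitute f (frag_of w) - frag_of w \<in> nonassoc_ideal H R"
  proof (induction w)
    case (Br u v)
    define p q where pq: "p = frag_of u" "q = frag_of v"
    have c: "p \<in> carrier (nonassoc H)" "q \<in> carrier (nonassoc H)"
      using Br.prems by (simp_all add: pq)
    have i: "substitute f p - p \<in> nonassoc_ideal H R" "substitute f q - q \<in> nonassoc_ideal H R"
      using Br by (simp_all add: pq)
    have "(substitute f p - p) + p \<in> carrier (nonassoc H)"
      by (rule frag_add_closed[OF subsetD[OF nonassoc_ideal_subset[OF R] i(1)] c(1)])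
    then have "br (substitute f p) (substitute f q - q) \<in> nonassoc_ideal H R"
      using nonassoc_ideal.left[OF i(2)] by simp
    from nonassoc_ideal_add[OF this nonassoc_ideal.right[OF i(1) c(2)]]
    have "br (substitute f p) (substitute f q) - br p q \<in> nonassoc_ideal H R"
      by (simp add: br_diff_left br_diff_right)
    then show ?case by (simp add: pq flip: substitute_br br_frag_of)
  qed (use f in simp)
qed simp


lemma substitute_substitute:
  "substitute g (substitute f x) = substitute (\<lambda>y. substitute g (f y)) x"
proof (rule frag_eqI[where S = UNIV and f = "\<lambda>x. substitute g (substitute f x)"])
  fix w
  show "substitute g (substitute f (frag_of w)) = substitute (\<lambda>y. substitute g (f y)) (frag_of w)"
    by (induction w) (simp_all flip: br_frag_of)
qed simp_all

text \<open>
  Expanding the elements of \<open>H\<close> in the basis \<open>B\<close> is a map \<open>f\<close> from words in \<open>H\<close> to expressions in the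
  basis letters, which turns the additivity relators into zero.  The map \<open>g\<close> in the other direction
  sends a basis letter to the corresponding element of \<open>H\<close>, and \<open>g\<close> after \<open>f\<close> is the identity
  modulo \<open>I\<close>.  So \<open>square_quasi2_imp_lie2\<close> carries over.
\<close>

lemma square_double_imp_lie_ideal:
  fixes B :: "'b set"
  assumes H: "comm_group H" and B: "finite B" and iso: "H \<cong> free_Abelian_group B"
    and x: "x \<in> carrier (nonassoc H)"
    and sq: "br x x - (b + b) \<in> nonassoc_ideal H (quasi_lie_relators H)"
  shows "\<exists>j \<in> nonassoc_ideal H (lie_relators H). \<exists>c \<in> carrier (nonassoc H). x = j + (c + c)"
proof -
  interpret H: comm_group H by fact
  let ?F = "free_Abelian_group B"
  let ?I = "nonassoc_ideal H (quasi_lie_relators H)"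
  obtain \<phi> where \<phi>: "\<phi> \<in> iso H ?F" using iso unfolding is_iso_def by blast
  define \<psi> where "\<psi> = inv_into (carrier H) \<phi>"
  have "\<psi> \<in> iso ?F H" unfolding \<psi>_def by (rule H.iso_set_sym[OF \<phi>])
  then have \<psi>: "\<psi> \<in> hom ?F H" by (simp add: iso_def)
  have \<phi>h: "\<phi> \<in> hom H ?F" and \<psi>\<phi>: "\<psi> (\<phi> h) = h" if "h \<in> carrier H" for h
    using \<phi> that by (auto simp: \<psi>_def iso_def bij_betw_def)
  obtain e :: "'b \<Rightarrow> nat" where e: "inj_on e B"
    using finite_imp_inj_to_nat_seg[OF B] by blast
  define f where "f h = frag_extend (\<lambda>b. frag_of (Gen (e b))) (\<phi> h)" for h
  \<comment> \<open>Letters that number no element of \<open>B\<close> do not occur in the range of \<open>f\<close>; they go to zero.\<close>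
  define g where "g n = (if n \<in> e ` B then frag_of (Gen (\<psi> (frag_of (inv_into B e n)))) else 0)" for n
  have \<psi>c: "\<psi> z \<in> carrier H" if "Poly_Mapping.keys z \<subseteq> B" for z
    using hom_in_carrier[OF \<psi>] that by simp
  have g: "g n \<in> carrier (nonassoc H)" for n
    using \<psi>c by (auto simp: g_def inv_into_into)
  have f_add: "f (a \<otimes>\<^bsub>H\<^esub> b) = f a + f b" if "a \<in> carrier H" "b \<in> carrier H" for a b
    using hom_mult[OF \<phi>h that] that by (simp add: f_def frag_extend_add)
  have gf: "substitute g (frag_extend (\<lambda>b. frag_of (Gen (e b))) z) - frag_of (Gen (\<psi> z)) \<in> ?I"
    if "Poly_Mapping.keys z \<subseteq> B" for z
    using that
  proof (induction z rule: frag_induct)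
    case zero
    have "\<psi> 0 = \<one>\<^bsub>H\<^esub>" using hom_one[OF \<psi>] H.is_group by simp
    then show ?case
      using quasi_lie_ideal_gen[OF H.one_closed H.one_closed] by simp
  next
    case (diff y z)
    have yz: "Poly_Mapping.keys (y - z) \<subseteq> B" using diff keys_diff[of y z] by blast
    then have "\<psi> (y - z) \<otimes>\<^bsub>H\<^esub> \<psi> z = \<psi> y"
      using hom_mult[OF \<psi>, of "y - z" z] diff by simp
    with quasi_lie_ideal_gen[OF \<psi>c[OF yz] \<psi>c[OF diff(2)]]
    have "frag_of (Gen (\<psi> y)) - (frag_of (Gen (\<psi> (y - z))) + frag_of (Gen (\<psi> z))) \<in> ?I"
      by simp
    from nonassoc_ideal_add[OF nonassoc_ideal.diff[OF diff(3,4)] this] show ?case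
      by (simp add: frag_extend_diff algebra_simps)
  next
    case (gen b)
    then show ?case using e by (simp add: g_def nonassoc_ideal.zero)
  qed
  have gf': "substitute g (f h) - frag_of (Gen h) \<in> ?I" if "h \<in> carrier H" for h
    using gf[of "\<phi> h"] hom_in_carrier[OF \<phi>h that] \<psi>\<phi>[OF that] that by (simp add: f_def)
  have gfx: "substitute g (substitute f x) - x \<in> ?I"
    unfolding substitute_substitute
    by (rule substitute_inverse_mod_ideal[OF gf' quasi_lie_relators_subset[OF H.monoid_axioms] x])
  have "br (substitute f x) (substitute f x) - (substitute f b + substitute f b) \<in> quasi2"
    using substitute_quasi_lie_ideal[OF f_add sq] by simp
  from quasi2_add[OF this quasi2.double[of "substitute f b"]]
  have "br (substitute f x) (substitute f x) \<in> quasi2" by simp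
  then have "substitute f x \<in> lie2" by (rule square_quasi2_imp_lie2)
  from substitute_lie2_ideal[where g = g, OF g this] obtain j c where jc:
    "j \<in> nonassoc_ideal H (lie_relators H)" "c \<in> carrier (nonassoc H)"
    "substitute g (substitute f x) = j + (c + c)" by (elim bexE)
  have "j - (substitute g (substitute f x) - x) \<in> nonassoc_ideal H (lie_relators H)"
    using jc(1) gfx quasi_lie_ideal_subset_lie_ideal by (blast intro: nonassoc_ideal.diff)
  moreover have "x = (j - (substitute g (substitute f x) - x)) + (c + c)"
    using jc(3) by (simp add: algebra_simps)
  ultimately show ?thesis using jc(2) by blast
qed

lemma square_double_imp_lie_ideal_homogeneous:
  assumes "comm_group H" "finite B" "H \<cong> free_Abelian_group B"
    and x: "Poly_Mapping.keys x \<subseteq> {w \<in> lie_words H. weight w = k}"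
    and sq: "br x x - (b + b) \<in> nonassoc_ideal H (quasi_lie_relators H)"
  shows "\<exists>c. Poly_Mapping.keys c \<subseteq> {w \<in> lie_words H. weight w = k}
    \<and> x - (c + c) \<in> nonassoc_ideal H (lie_relators H)"
proof -
  interpret H: comm_group H by fact
  have "x \<in> carrier (nonassoc H)" using x by auto
  from square_double_imp_lie_ideal[OF assms(1-3) this sq]
  obtain j c where jc: "j \<in> nonassoc_ideal H (lie_relators H)" "c \<in> carrier (nonassoc H)"
    "x = j + (c + c)" by blast
  have "x = degree_part k x" using x by (intro degree_part_eq[symmetric]) blast
  also have "\<dots> = degree_part k j + (degree_part k c + degree_part k c)"
    by (simp add: jc(3))
  finally have "x - (degree_part k c + degree_part k c) = degree_part k j"
    using diff_eq_eq by blast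
  moreover have "Poly_Mapping.keys (degree_part k c) \<subseteq> {w \<in> lie_words H. weight w = k}"
    using keys_degree_part[of k c] jc(2) by auto
  ultimately show ?thesis
    using lie_ideal_homogeneous[OF H.monoid_axioms jc(1), of k]
    by (intro exI[where x = "degree_part k c"]) simp
qed


section \<open>Splitting off a pure elementary abelian subgroup\<close>

text \<open>
  By Zorn's lemma there is a subgroup \<open>N\<close> that is maximal among those that contain all squares and
  meet \<open>V\<close> trivially; the set of squares is one of them by purity.  If \<open>a\<close> is not in \<open>N\<close>, then
  \<open>N \<union> N a\<close> is a subgroup, since \<open>a\<^sup>2\<close> is in \<open>N\<close>.  By maximality it contains a nontrivial element
  \<open>v = n a\<close> of \<open>V\<close>, so \<open>a\<close> is in \<open>V N\<close>.
\<close>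

lemma (in comm_group) ex_complement:
  assumes V: "subgroup V G"
    and pure: "\<And>a. a \<in> carrier G \<Longrightarrow> a \<otimes> a \<in> V \<Longrightarrow> a \<otimes> a = \<one>"
  shows "\<exists>N. subgroup N G \<and> N \<inter> V = {\<one>} \<and> (\<forall>a \<in> carrier G. \<exists>v \<in> V. \<exists>n \<in> N. a = v \<otimes> n)"
proof -
  interpret V: subgroup V G by fact
  define \<A> where "\<A> = {N. subgroup N G \<and> (\<forall>a \<in> carrier G. a \<otimes> a \<in> N) \<and> N \<inter> V = {\<one>}}"
  have "(\<lambda>a. a \<otimes> a) ` carrier G \<in> \<A>"
  proof -
    have sub: "subgroup ((\<lambda>a. a \<otimes> a) ` carrier G) G"
    proof (rule subgroupI)
      fix y z assume y: "y \<in> (\<lambda>a. a \<otimes> a) ` carrier G" and z: "z \<in> (\<lambda>a. a \<otimes> a) ` carrier G"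
      from y obtain a where a: "a \<in> carrier G" "y = a \<otimes> a" by blast
      from z obtain b where b: "b \<in> carrier G" "z = b \<otimes> b" by blast
      show "inv y \<in> (\<lambda>a. a \<otimes> a) ` carrier G"
        using a by (intro image_eqI[of _ _ "inv a"]) (simp_all add: inv_mult)
      show "y \<otimes> z \<in> (\<lambda>a. a \<otimes> a) ` carrier G"
        using a b by (intro image_eqI[of _ _ "a \<otimes> b"]) (simp_all add: m_ac)
    qed auto
    have "\<one> \<in> (\<lambda>a. a \<otimes> a) ` carrier G" by (rule image_eqI[of _ _ \<one>]) simp_all
    then have "(\<lambda>a. a \<otimes> a) ` carrier G \<inter> V = {\<one>}"
      using pure V.one_closed by blast
    then show ?thesis using sub by (simp add: \<A>_def)
  qed
  moreover have "\<Union>\<C> \<in> \<A>" if \<C>: "\<C> \<noteq> {}" "subset.chain \<A> \<C>" for \<C>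
  proof -
    have mem: "N \<in> \<A>" if "N \<in> \<C>" for N using \<C>(2) that by (auto simp: subset.chain_def)
    then have sub: "subgroup N G" if "N \<in> \<C>" for N using that by (auto simp: \<A>_def)
    obtain N0 where N0: "N0 \<in> \<C>" using \<C>(1) by blast
    have "subgroup (\<Union>\<C>) G"
    proof (rule subgroupI)
      show "\<Union>\<C> \<subseteq> carrier G" using sub subgroup.subset by blast
      show "\<Union>\<C> \<noteq> {}" using N0 subgroup.one_closed[OF sub] by blast
      fix y assume "y \<in> \<Union>\<C>"
      then obtain N where N: "N \<in> \<C>" "y \<in> N" by blast
      show "inv y \<in> \<Union>\<C>" using N subgroup.m_inv_closed[OF sub] by blast
      fix z assume "z \<in> \<Union>\<C>"
      then obtain N' where N': "N' \<in> \<C>" "z \<in> N'" by blast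
      have "N \<subseteq> N' \<or> N' \<subseteq> N" using \<C>(2) N(1) N'(1) by (auto simp: subset.chain_def)
      then show "y \<otimes> z \<in> \<Union>\<C>"
        using N N' subgroup.m_closed[OF sub[OF N(1)]] subgroup.m_closed[OF sub[OF N'(1)]] by blast
    qed
    then show ?thesis using mem N0 unfolding \<A>_def by blast
  qed
  ultimately obtain N where N: "N \<in> \<A>" and max: "\<And>M. M \<in> \<A> \<Longrightarrow> N \<subseteq> M \<Longrightarrow> M = N"
    using subset_Zorn_nonempty[of \<A>] by blast
  interpret N: subgroup N G using N by (simp add: \<A>_def)
  have sqN: "a \<otimes> a \<in> N" if "a \<in> carrier G" for a using N that by (simp add: \<A>_def)
  have NV: "N \<inter> V = {\<one>}" using N by (simp add: \<A>_def)
  have "\<exists>v \<in> V. \<exists>n \<in> N. a = v \<otimes> n" if a: "a \<in> carrier G" for a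
  proof (cases "a \<in> N")
    case True
    then show ?thesis using a by (intro bexI[of _ \<one>] bexI[of _ a]) simp_all
  next
    case False
    define M where "M = N \<union> (\<lambda>n. n \<otimes> a) ` N"
    have mulN: "n \<otimes> (n' \<otimes> a) \<in> M" "(n \<otimes> a) \<otimes> n' \<in> M" "(n \<otimes> a) \<otimes> (n' \<otimes> a) \<in> M"
      if "n \<in> N" "n' \<in> N" for n n'
    proof -
      have nn: "n \<otimes> n' \<in> N" using that by simp
      have "n \<otimes> (n' \<otimes> a) = (n \<otimes> n') \<otimes> a" "(n \<otimes> a) \<otimes> n' = (n \<otimes> n') \<otimes> a"
        using that a by (simp_all add: m_ac)
      then show "n \<otimes> (n' \<otimes> a) \<in> M" "(n \<otimes> a) \<otimes> n' \<in> M"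
        using nn unfolding M_def by blast+
      have "(n \<otimes> a) \<otimes> (n' \<otimes> a) = (n \<otimes> n') \<otimes> (a \<otimes> a)" using that a by (simp add: m_ac)
      then show "(n \<otimes> a) \<otimes> (n' \<otimes> a) \<in> M" using that sqN[OF a] by (simp add: M_def)
    qed
    have invN: "inv (n \<otimes> a) \<in> M" if "n \<in> N" for n
    proof -
      have "inv (n \<otimes> a) = (inv n \<otimes> inv (a \<otimes> a)) \<otimes> a"
        using that a by (simp add: inv_mult m_assoc)
      moreover have "inv n \<otimes> inv (a \<otimes> a) \<in> N" using that sqN[OF a] by simp
      ultimately show ?thesis unfolding M_def by blast
    qed
    have M: "subgroup M G"
    proof (rule subgroupI)
      show "M \<subseteq> carrier G" using a by (auto simp: M_def)
      show "M \<noteq> {}" using N.one_closed unfolding M_def by blast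
      fix y assume y: "y \<in> M"
      show "inv y \<in> M" using y invN by (auto simp: M_def)
      fix z assume z: "z \<in> M"
      show "y \<otimes> z \<in> M"
      proof -
        have M_cases: "w \<in> N \<or> (\<exists>n \<in> N. w = n \<otimes> a)" if "w \<in> M" for w
          using that by (auto simp: M_def)
        have "y \<otimes> z \<in> M" if "y \<in> N" "z \<in> N" using that by (simp add: M_def)
        then show ?thesis using M_cases[OF y] M_cases[OF z] mulN by (elim disjE bexE) simp_all
      qed
    qed
    have "a \<in> M" using imageI[OF N.one_closed, of "\<lambda>n. n \<otimes> a"] a by (simp add: M_def)
    then have "M \<noteq> N" using False by blast
    then have "M \<notin> \<A>" using max[of M] by (auto simp: M_def)
    then have "M \<inter> V \<noteq> {\<one>}" using M sqN by (auto simp: \<A>_def M_def)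
    then obtain v where v: "v \<in> M" "v \<in> V" "v \<noteq> \<one>"
      using V.one_closed subgroup.one_closed[OF M] by blast
    then obtain n where n: "n \<in> N" "v = n \<otimes> a" using NV by (auto simp: M_def)
    have "a = v \<otimes> inv n" using n a by (simp add: m_ac inv_solve_right)
    then show ?thesis using v(2) n(1) by blast
  qed
  then show ?thesis using N.subgroup_axioms NV by blast
qed

lemma ex_section:
  assumes A: "comm_group A" and C: "group C" and g: "g \<in> epi A C"
    and pure: "\<And>a. a \<in> carrier A \<Longrightarrow> g (a \<otimes>\<^bsub>A\<^esub> a) = \<one>\<^bsub>C\<^esub> \<Longrightarrow> a \<otimes>\<^bsub>A\<^esub> a = \<one>\<^bsub>A\<^esub>"
  shows "\<exists>s \<in> hom C A. \<forall>x \<in> carrier C. g (s x) = x"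
proof -
  interpret A: comm_group A by fact
  interpret g: group_hom A C g
    using A.is_group C g by (simp add: group_hom_def group_hom_axioms_def epi_def)
  have im: "g ` carrier A = carrier C" using g by (simp add: epi_def)
  obtain N where N: "subgroup N A" "N \<inter> kernel A C g = {\<one>\<^bsub>A\<^esub>}"
    "\<And>a. a \<in> carrier A \<Longrightarrow> \<exists>v \<in> kernel A C g. \<exists>n \<in> N. a = v \<otimes>\<^bsub>A\<^esub> n"
    using A.ex_complement[OF g.subgroup_kernel] pure by (auto simp: kernel_def)
  interpret N: subgroup N A by (rule N(1))
  have inj: "n = n'" if "n \<in> N" "n' \<in> N" "g n = g n'" for n n'
  proof -
    have "n \<otimes>\<^bsub>A\<^esub> inv\<^bsub>A\<^esub> n' \<in> N \<inter> kernel A C g" using that by (simp add: kernel_def)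
    then have "n \<otimes>\<^bsub>A\<^esub> inv\<^bsub>A\<^esub> n' = \<one>\<^bsub>A\<^esub>" unfolding N(2) by simp
    then show ?thesis using that by (metis A.inv_closed A.inv_equality A.inv_inv N.mem_carrier)
  qed
  have surj: "\<exists>n \<in> N. g n = x" if x: "x \<in> carrier C" for x
  proof -
    obtain a where a: "a \<in> carrier A" "g a = x" using x im by (metis imageE)
    obtain v n where "v \<in> kernel A C g" "n \<in> N" "a = v \<otimes>\<^bsub>A\<^esub> n" using N(3)[OF a(1)] by blast
    then show ?thesis using a by (auto simp: kernel_def)
  qed
  define s where "s x = (SOME n. n \<in> N \<and> g n = x)" for x
  have s: "s x \<in> N" "g (s x) = x" if "x \<in> carrier C" for x
    using someI_ex[of "\<lambda>n. n \<in> N \<and> g n = x"] surj[OF that] unfolding s_def by blast+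
  have "s \<in> hom C A"
  proof (rule homI)
    fix x y assume xy: "x \<in> carrier C" "y \<in> carrier C"
    show "s x \<in> carrier A" using s(1)[OF xy(1)] by simp
    show "s (x \<otimes>\<^bsub>C\<^esub> y) = s x \<otimes>\<^bsub>A\<^esub> s y"
      by (rule inj) (use s xy in simp_all)
  qed
  then show ?thesis using s(2) by blast
qed


section \<open>Exactness\<close>

text \<open>
  The tensors \<open>a \<otimes> 1\<close> form a subgroup that contains the generators, as \<open>a \<otimes> 0\<close> is zero.
\<close>

lemma tensor_integer_mod_2_pure:
  assumes A: "comm_group A" and U: "U \<in> carrier (tensor A (integer_mod_group 2))"
  shows "\<exists>a \<in> carrier A. U = pure_tensor A (integer_mod_group 2) a 1"
proof -
  let ?Z = "integer_mod_group 2"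
  let ?F = "free_Abelian_group (carrier A \<times> carrier ?Z)"
  let ?T = "tensor A ?Z"
  let ?cl = "\<lambda>x. tensor_kernel A ?Z #>\<^bsub>?F\<^esub> x"
  interpret A: comm_group A by fact
  interpret Z: comm_group ?Z by simp
  note M = A.monoid_axioms Z.monoid_axioms
  interpret T: comm_group ?T by (rule comm_group_tensor[OF M])
  have cl: "?cl \<in> hom ?F ?T"
    unfolding tensor_def by (rule normal.r_coset_hom_Mod[OF tensor_kernel_normal[OF M]])
  interpret cl: group_hom ?F ?T ?cl
    by (intro group_hom.intro group_hom_axioms.intro cl T.is_group) simp
  have Zc: "carrier ?Z = {0, 1}" by (auto simp: carrier_integer_mod_group)
  let ?p = "pure_tensor A ?Z"
  have pc: "?p a 1 \<in> carrier ?T" if "a \<in> carrier A" for a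
    by (rule pure_tensor_closed[OF that]) simp
  have pm: "?p (a \<otimes>\<^bsub>A\<^esub> b) 1 = ?p a 1 \<otimes>\<^bsub>?T\<^esub> ?p b 1" if "a \<in> carrier A" "b \<in> carrier A" for a b
    by (rule pure_tensor_mult(1)[OF M that]) simp
  have p1: "?p \<one>\<^bsub>A\<^esub> 1 = \<one>\<^bsub>?T\<^esub>"
    using pm[OF A.one_closed A.one_closed] pc[OF A.one_closed] by (metis A.l_one A.one_closed T.l_cancel_one')
  have p0: "?p a 0 = \<one>\<^bsub>?T\<^esub>" if "a \<in> carrier A" for a
  proof -
    have "?p a 0 \<in> carrier ?T" by (rule pure_tensor_closed[OF that]) simp
    moreover have "?p a 0 = ?p a 0 \<otimes>\<^bsub>?T\<^esub> ?p a 0"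
      using pure_tensor_mult(2)[OF M that, of 0 0] by simp
    ultimately show ?thesis by (metis T.l_cancel_one')
  qed
  obtain x where x: "Poly_Mapping.keys x \<subseteq> carrier A \<times> carrier ?Z" "U = ?cl x"
    using U by (auto simp: tensor_def carrier_FactGroup)
  have "\<exists>a \<in> carrier A. ?cl x = ?p a 1"
    using x(1)
  proof (induction x rule: frag_induct)
    case zero
    show ?case using cl.hom_one p1 A.one_closed by auto
  next
    case (diff y z)
    then obtain a b where ab: "a \<in> carrier A" "?cl y = ?p a 1" "b \<in> carrier A" "?cl z = ?p b 1"
      by blast
    have c: "y \<in> carrier ?F" "z \<in> carrier ?F" using diff by simp_all
    have "?cl (y - z) = ?cl y \<otimes>\<^bsub>?T\<^esub> inv\<^bsub>?T\<^esub> ?cl z"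
    proof -
      have "y - z = y \<otimes>\<^bsub>?F\<^esub> inv\<^bsub>?F\<^esub> z" using c by simp
      then show ?thesis using c cl.hom_mult cl.hom_inv cl.G.inv_closed by metis
    qed
    also have "inv\<^bsub>?T\<^esub> ?cl z = ?p (inv\<^bsub>A\<^esub> b) 1"
      using pm[of "inv\<^bsub>A\<^esub> b" b] p1 ab(3) pc[of b] pc[of "inv\<^bsub>A\<^esub> b"]
      unfolding ab(4) by (simp add: T.inv_equality)
    finally show ?case using pm[of a "inv\<^bsub>A\<^esub> b"] ab by auto
  next
    case (gen q)
    then obtain a m where q: "q = (a, m)" "a \<in> carrier A" "m = 0 \<or> m = 1" using Zc by blast
    have "?cl (frag_of q) = ?p a m" using q by (simp add: pure_tensor_def)
    then show ?case using q p0[of a] p1 A.one_closed by metis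
  qed
  then show ?thesis using x(2) by simp
qed

lemma pure_tensor_double:
  assumes "comm_group A" "a \<in> carrier A"
  shows "pure_tensor A (integer_mod_group 2) (a \<otimes>\<^bsub>A\<^esub> a) 1 = \<one>\<^bsub>tensor A (integer_mod_group 2)\<^esub>"
proof -
  let ?Z = "integer_mod_group 2"
  let ?T = "tensor A ?Z"
  let ?p = "pure_tensor A ?Z"
  interpret A: comm_group A by fact
  interpret Z: comm_group ?Z by simp
  note M = A.monoid_axioms Z.monoid_axioms
  interpret T: comm_group ?T by (rule comm_group_tensor[OF M])
  have c: "?p a 0 \<in> carrier ?T" by (rule pure_tensor_closed[OF assms(2)]) simp
  have "?p (a \<otimes>\<^bsub>A\<^esub> a) 1 = ?p a 1 \<otimes>\<^bsub>?T\<^esub> ?p a 1"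
    by (rule pure_tensor_mult(1)[OF M assms(2,2)]) simp
  also have "\<dots> = ?p a (1 \<otimes>\<^bsub>?Z\<^esub> 1)"
    by (rule pure_tensor_mult(2)[OF M assms(2), symmetric]) simp_all
  also have "\<dots> = ?p a 0" by simp
  also have "\<dots> = \<one>\<^bsub>?T\<^esub>"
    using pure_tensor_mult(2)[OF M assms(2), of 0 0] c by (metis T.l_cancel_one' Z.l_one Z.one_closed one_integer_mod_group)
  finally show ?thesis .
qed

context
  fixes H :: "('h, 'm) monoid_scheme"
  assumes H: "monoid H"
begin

lemma quasi_lie_part_subset: "carrier (quasi_lie_part H n) \<subseteq> carrier (free_quasi_lie H)"
proof -
  interpret Q: quasi_lie_algebra "free_quasi_lie H"
    by (rule quasi_lie_algebra_free_quasi_lie[OF H])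
  show ?thesis unfolding quasi_lie_part_def by (rule Q.carrier_subgroup_generated_subset)
qed

lemma gamma_square:
  assumes "a \<in> carrier (quasi_lie_part H k)"
  shows "gamma H (2 * k) (bracket (free_quasi_lie H) a a) = \<one>\<^bsub>lie_part H (2 * k)\<^esub>"
proof -
  interpret L: lie_algebra "free_lie H" by (rule lie_algebra_free_lie[OF H])
  have a: "a \<in> carrier (free_quasi_lie H)" using assms quasi_lie_part_subset by blast
  note hom = quasi_lie_to_lie_hom(1)[OF H]
  have "quasi_lie_to_lie H a \<in> carrier (free_lie H)"
    using hom a by (auto simp: lie_hom_def hom_def)
  then show ?thesis
    using hom a bracket_square(3)[OF H assms] L.bracket_self
    by (simp add: gamma_def lie_hom_def part_simps)
qed

lemma kernel_gamma_square:
  assumes b: "b \<in> carrier (quasi_lie_part H (2 * k))"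
    and ker: "gamma H (2 * k) b = \<one>\<^bsub>lie_part H (2 * k)\<^esub>"
  shows "\<exists>a \<in> carrier (quasi_lie_part H k). b = bracket (free_quasi_lie H) a a"
proof -
  let ?I = "nonassoc_ideal H (quasi_lie_relators H)" and ?J = "nonassoc_ideal H (lie_relators H)"
  note R = quasi_lie_relators_subset[OF H]
  obtain x where x: "Poly_Mapping.keys x \<subseteq> {w \<in> lie_words H. weight w = 2 * k}"
      "b = ?I #>\<^bsub>nonassoc H\<^esub> x"
    using b unfolding carrier_quasi_lie_part[OF H] by blast
  have "?J #>\<^bsub>nonassoc H\<^esub> x = ?J #>\<^bsub>nonassoc H\<^esub> 0"
    using ker x gamma_coset[OF H x(1)] one_nonassoc_quot[OF lie_relators_subset[OF H]]
    by (simp add: part_simps free_lie_def)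
  then have "x \<in> ?J" unfolding nonassoc_coset_eq by simp
  from lie_ideal_degree_part[OF H this, of "2 * k"] obtain y where
    y: "Poly_Mapping.keys y \<subseteq> {w \<in> lie_words H. weight w = k}" "degree_part (2 * k) x - br y y \<in> ?I"
    by auto
  have "degree_part (2 * k) x = x" using x(1) by (intro degree_part_eq) blast
  then have "b = ?I #>\<^bsub>nonassoc H\<^esub> br y y"
    using y(2) x(2) by (simp add: nonassoc_coset_eq)
  moreover have "y \<in> carrier (nonassoc H)" using y(1) by auto
  moreover have "?I #>\<^bsub>nonassoc H\<^esub> y \<in> carrier (quasi_lie_part H k)"
    unfolding carrier_quasi_lie_part[OF H] using y(1) by blast
  ultimately show ?thesis
    by (intro bexI[of _ "?I #>\<^bsub>nonassoc H\<^esub> y"])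
      (simp_all add: free_quasi_lie_def bracket_nonassoc_quot[OF R])
qed

end

text \<open>
  This gives both the injectivity of \<open>theta\<close> (when \<open>b\<close> is zero) and the purity of its image.
\<close>

lemma square_eq_double_imp_gamma_double:
  assumes H: "comm_group H" "finite B" "H \<cong> free_Abelian_group B"
    and a: "a \<in> carrier (quasi_lie_part H k)" and b: "b \<in> carrier (free_quasi_lie H)"
    and eq: "bracket (free_quasi_lie H) a a = b \<otimes>\<^bsub>free_quasi_lie H\<^esub> b"
  shows "\<exists>\<beta> \<in> carrier (lie_part H k). gamma H k a = \<beta> \<otimes>\<^bsub>lie_part H k\<^esub> \<beta>"
proof -
  interpret H: comm_group H by (rule H(1))
  let ?I = "nonassoc_ideal H (quasi_lie_relators H)" and ?J = "nonassoc_ideal H (lie_relators H)"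
  note R = quasi_lie_relators_subset[OF H.monoid_axioms]
  note R' = lie_relators_subset[OF H.monoid_axioms]
  obtain x where x: "Poly_Mapping.keys x \<subseteq> {w \<in> lie_words H. weight w = k}"
      "a = ?I #>\<^bsub>nonassoc H\<^esub> x"
    using a unfolding carrier_quasi_lie_part[OF H.monoid_axioms] by blast
  have xc: "x \<in> carrier (nonassoc H)" using x(1) by auto
  obtain y where y: "y \<in> carrier (nonassoc H)" "b = ?I #>\<^bsub>nonassoc H\<^esub> y"
    using b unfolding free_quasi_lie_def carrier_nonassoc_quot[OF R] by blast
  have "?I #>\<^bsub>nonassoc H\<^esub> br x x = ?I #>\<^bsub>nonassoc H\<^esub> (y + y)"
    using eq x(2) y xc
    by (simp add: free_quasi_lie_def bracket_nonassoc_quot[OF R] mult_nonassoc_quot[OF R]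
        del: carrier_free_Abelian_group_iff)
  then have "br x x - (y + y) \<in> ?I" unfolding nonassoc_coset_eq .
  from square_double_imp_lie_ideal_homogeneous[OF H x(1) this] obtain c where
    c: "Poly_Mapping.keys c \<subseteq> {w \<in> lie_words H. weight w = k}" "x - (c + c) \<in> ?J" by blast
  have cc: "c \<in> carrier (nonassoc H)" using c(1) by auto
  have "gamma H k a = ?J #>\<^bsub>nonassoc H\<^esub> (c + c)"
    using gamma_coset[OF H.monoid_axioms x(1)] x(2) c(2) by (simp add: nonassoc_coset_eq)
  also have "\<dots> = (?J #>\<^bsub>nonassoc H\<^esub> c) \<otimes>\<^bsub>lie_part H k\<^esub> (?J #>\<^bsub>nonassoc H\<^esub> c)"
    using cc by (simp add: part_simps free_lie_def mult_nonassoc_quot[OF R'])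
  finally show ?thesis
    unfolding carrier_lie_part[OF H.monoid_axioms] using c(1) by blast
qed

theorem theorem2p2:
  fixes H :: "('h, 'm) monoid_scheme" and B :: "'b set" and k :: nat
  assumes "comm_group H"
    and "finite B" and "H \<cong> free_Abelian_group B"
    and "k \<ge> 1"
  shows "short_exact (tensor (lie_part H k) (integer_mod_group 2)) (theta H k)
           (quasi_lie_part H (2 * k)) (gamma H (2 * k)) (lie_part H (2 * k))
       \<and> (\<exists>s \<in> hom (lie_part H (2 * k)) (quasi_lie_part H (2 * k)).
           \<forall>x \<in> carrier (lie_part H (2 * k)). gamma H (2 * k) (s x) = x)"
proof -
  interpret H: comm_group H by fact
  note M = H.monoid_axioms
  let ?P = "lie_part H k" and ?Z = "integer_mod_group 2"
  let ?T = "tensor ?P ?Z" and ?Q = "quasi_lie_part H (2 * k)" and ?L = "lie_part H (2 * k)"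
  let ?b = "bracket (free_quasi_lie H)"
  interpret P: comm_group ?P by (rule comm_group_lie_part[OF M])
  interpret Q: comm_group ?Q by (rule comm_group_quasi_lie_part[OF M])
  interpret L: comm_group ?L by (rule comm_group_lie_part[OF M])
  interpret Z: comm_group ?Z by simp
  interpret T: comm_group ?T by (rule comm_group_tensor[OF P.monoid_axioms Z.monoid_axioms])
  note \<theta> = theta_props[OF M, where k = k]
  interpret \<theta>: group_hom ?T ?Q "theta H k"
    by (intro group_hom.intro group_hom_axioms.intro T.is_group Q.is_group \<theta>(1))
  have \<gamma>: "gamma H (2 * k) \<in> epi ?Q ?L" by (rule gamma_epi[OF M])
  have \<gamma>k: "gamma H k ` carrier (quasi_lie_part H k) = carrier ?P"
    using gamma_epi[OF M, of k] by (simp add: epi_def)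
  have tensor: "\<exists>a \<in> carrier (quasi_lie_part H k). U = pure_tensor ?P ?Z (gamma H k a) 1"
    if "U \<in> carrier ?T" for U
  proof -
    obtain \<alpha> where \<alpha>: "\<alpha> \<in> carrier ?P" "U = pure_tensor ?P ?Z \<alpha> 1"
      using tensor_integer_mod_2_pure[OF P.comm_group_axioms \<open>U \<in> carrier ?T\<close>] by (elim bexE)
    from \<alpha>(1) have "\<alpha> \<in> gamma H k ` carrier (quasi_lie_part H k)" unfolding \<gamma>k .
    then show ?thesis using \<alpha>(2) by (elim imageE) (rule bexI; simp)
  qed
  have pure: "pure_tensor ?P ?Z (gamma H k a) 1 = \<one>\<^bsub>?T\<^esub>"
    if ab: "a \<in> carrier (quasi_lie_part H k)" "b \<in> carrier ?Q" "?b a a = b \<otimes>\<^bsub>?Q\<^esub> b" for a b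
  proof -
    have "b \<in> carrier (free_quasi_lie H)" using ab(2) quasi_lie_part_subset[OF M] by blast
    moreover have "?b a a = b \<otimes>\<^bsub>free_quasi_lie H\<^esub> b" using ab(3) by (simp add: part_simps)
    ultimately obtain \<beta> where "\<beta> \<in> carrier ?P" "gamma H k a = \<beta> \<otimes>\<^bsub>?P\<^esub> \<beta>"
      using square_eq_double_imp_gamma_double[OF assms(1-3) ab(1)] by blast
    then show ?thesis using pure_tensor_double[OF P.comm_group_axioms] by simp
  qed
  have "inj_on (theta H k) (carrier ?T)"
  proof (rule \<theta>.inj_on_one_iff[THEN iffD2], intro allI impI)
    fix U assume U: "U \<in> carrier ?T" "theta H k U = \<one>\<^bsub>?Q\<^esub>"
    obtain a where a: "a \<in> carrier (quasi_lie_part H k)" "U = pure_tensor ?P ?Z (gamma H k a) 1"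
      using tensor[OF U(1)] by blast
    show "U = \<one>\<^bsub>?T\<^esub>"
      using pure[OF a(1) Q.one_closed] U(2) \<theta>(2)[OF a(1)] a(2) by simp
  qed
  then have mon: "theta H k \<in> mon ?T ?Q" using \<theta>(1) by (simp add: mon_def)
  have ker: "\<exists>a \<in> carrier (quasi_lie_part H k). b = ?b a a"
    if "b \<in> carrier ?Q" "gamma H (2 * k) b = \<one>\<^bsub>?L\<^esub>" for b
    using kernel_gamma_square[OF M that] .
  have "theta H k ` carrier ?T = kernel ?Q ?L (gamma H (2 * k))"
  proof
    show "theta H k ` carrier ?T \<subseteq> kernel ?Q ?L (gamma H (2 * k))"
    proof (rule image_subsetI)
      fix U assume U: "U \<in> carrier ?T"
      then obtain a where "a \<in> carrier (quasi_lie_part H k)" "theta H k U = ?b a a"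
        using tensor \<theta>(2) by metis
      then show "theta H k U \<in> kernel ?Q ?L (gamma H (2 * k))"
        using \<theta>.hom_closed[OF U] gamma_square[OF M] by (simp add: kernel_def)
    qed
    show "kernel ?Q ?L (gamma H (2 * k)) \<subseteq> theta H k ` carrier ?T"
    proof
      fix b assume "b \<in> kernel ?Q ?L (gamma H (2 * k))"
      then obtain a where a: "a \<in> carrier (quasi_lie_part H k)" "b = ?b a a"
        using ker by (auto simp: kernel_def)
      have "gamma H k a \<in> carrier ?P" using a(1) \<gamma>k by blast
      then have "pure_tensor ?P ?Z (gamma H k a) 1 \<in> carrier ?T"
        by (rule pure_tensor_closed) simp
      then show "b \<in> theta H k ` carrier ?T" using \<theta>(2)[OF a(1)] a(2) by (metis imageI)
    qed
  qed
  then have "short_exact ?T (theta H k) ?Q (gamma H (2 * k)) ?L"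
    unfolding short_exact_def using mon \<gamma> T.is_group Q.is_group L.is_group by (intro conjI)
  moreover have "\<exists>s \<in> hom ?L ?Q. \<forall>x \<in> carrier ?L. gamma H (2 * k) (s x) = x"
  proof (rule ex_section[OF Q.comm_group_axioms L.is_group \<gamma>])
    fix b assume b: "b \<in> carrier ?Q" "gamma H (2 * k) (b \<otimes>\<^bsub>?Q\<^esub> b) = \<one>\<^bsub>?L\<^esub>"
    obtain a where a: "a \<in> carrier (quasi_lie_part H k)" "b \<otimes>\<^bsub>?Q\<^esub> b = ?b a a"
      using ker[OF Q.m_closed[OF b(1) b(1)] b(2)] by blast
    show "b \<otimes>\<^bsub>?Q\<^esub> b = \<one>\<^bsub>?Q\<^esub>"
      using \<theta>(2)[OF a(1)] pure[OF a(1) b(1) a(2)[symmetric]] a(2) \<theta>.hom_one by simp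
  qed
  ultimately show ?thesis ..
qed

end
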